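(* Assume that for every $\theta\in\Theta$ the functions $x\mapsto F_0(x,\theta)$ and $x\mapsto F(x,\theta)$ are $C^1$-regular, as well as the function $x\mapsto a(x,\theta)$. Let $\theta_1,\dots,\theta_N\in\Theta$ and $\mu_N=\sum_{j=1}^N\alpha_j\delta_{\theta_j}$ with $\alpha_j>0$, $\sum_{j=1}^N\alpha_j=1$. Let $\hat u_N=(\hat u_{N,1},\dots,\hat u_{N,k})\in\mathcal{U}$ be a local minimizer (with respect to the $L^2$ norm) of the functional $\mathcal{F}^N:\mathcal{U}\to\mathbb{R}_+$, $$\mathcal{F}^N(u)=\int_\Theta a(x_u^\theta(1),\theta)\,d\mu_N(\theta)+\frac{\beta}{2}\|u\|_{L^2}^2=\sum_{j=1}^N\alpha_j\,a(x_u^{\theta_j}(1),\theta_j)+\frac{\beta}{2}\|u\|_{L^2}^2 .$$ Then for every $j=1,\dots,N$ there exists an (absolutely continuous) curve of covectors $\lambda_{\hat u_N}^j:[0,1]\to(\mathbb{R}^n)^*$ such that $$\begin{cases}\dot\lambda_{\hat u_N}^j(t)=-\lambda_{\hat u_N}^j(t)\left(\frac{\partial F_0(x_{\hat u_N}^{\theta_j}(t),\theta_j)}{\partial x}+\sum_{i=1}^k\hat u_{N,i}(t)\frac{\partial F_i(x_{\hat u_N}^{\theta_j}(t),\theta_j)}{\partial x}\right)&\text{a.e. in }[0,1],\\ \lambda_{\hat u_N}^j(1)=\nabla_x a(x_{\hat u_N}^{\theta_j}(1),\theta_j),\end{cases}$$ and such that $$\hat u_N(t)\in\arg\max_{v\in\mathbb{R}^k}\left\{\sum_{j=1}^N\alpha_j\left(-\lambda_{\hat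 u_N}^j(t)\cdot F(x_{\hat u_N}^{\theta_j}(t),\theta_j)\cdot v\right)-\frac{\beta}{2}|v|_2^2\right\}$$ for a.e. $t\in[0,1]$.
   Context: Let $n,k,N\ge 1$ and let $\Theta$ be a compact subset of a finite-dimensional Euclidean space. Let $F_0:\mathbb{R}^n\times\Theta\to\mathbb{R}^n$ and $F=(F_1,\dots,F_k):\mathbb{R}^n\times\Theta\to\mathbb{R}^{n\times k}$ ($F_i$ is the $i$-th column of $F$) be such that, for some $L>0$, $|F_i(x_1,\theta_1)-F_i(x_2,\theta_2)|_2\le L(|x_1-x_2|_2+|\theta_1-\theta_2|_2)$ for all $i=0,\dots,k$ and all $(x_1,\theta_1),(x_2,\theta_2)\in\mathbb{R}^n\times\Theta$. Let $x_0:\Theta\to\mathbb{R}^n$ be continuous. Set $\mathcal{U}:=L^2([0,1],\mathbb{R}^k)$. For $u\in\mathcal{U}$ and $\theta\in\Theta$, $x_u^\theta:[0,1]\to\mathbb{R}^n$ is the unique absolutely continuous solution of $\dot x(t)=F_0(x(t),\theta)+F(x(t),\theta)u(t)$ for a.e. $t\in[0,1]$, $x(0)=x_0(\theta)$. The function $a:\mathbb{R}^n\times\Theta\to\mathbb{R}_+$ is continuous and non-negative, $\beta>0$. Elements of $(\mathbb{R}^n)^*$ are row vectors, and $\nabla_x a$ is regarded as a row vector. *)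

theory Defs
  imports "HOL-Analysis.Analysis"
begin

text \<open>Square-integrable functions on the unit interval are represented by functions on the whole
  real line, of which only the restriction to the interval matters; two functions that agree
  almost everywhere represent the same element of the quotient space.\<close>

definition L2_unit :: "(real \<Rightarrow> 'a::euclidean_space) set" where
  "L2_unit = {u. u \<in> borel_measurable (lebesgue_on {0..1}) \<and>
                 integrable (lebesgue_on {0..1}) (\<lambda>t. (norm (u t))\<^sup>2)}"

definition L2_unit_norm :: "(real \<Rightarrow> 'a::euclidean_space) \<Rightarrow> real" where
  "L2_unit_norm u = sqrt (LINT t|lebesgue_on {0..1}. (norm (u t))\<^sup>2)"

text \<open>The finite sets \<open>P\<close> below are sets of pairs of endpoints of non-overlapping intervals.\<close>

definition abs_cont_on_interval :: "real \<Rightarrow> real \<Rightarrow> (real \<Rightarrow> 'a::real_normed_vector) \<Rightarrow> bool" where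
  "abs_cont_on_interval a b f \<longleftrightarrow>
     (\<forall>\<epsilon>>0. \<exists>\<delta>>0. \<forall>P :: (real \<times> real) set.
        finite P \<and> (\<forall>(s, t)\<in>P. a \<le> s \<and> s < t \<and> t \<le> b) \<and>
        disjoint_family_on (\<lambda>(s, t). {s<..<t}) P \<and> (\<Sum>(s, t)\<in>P. t - s) < \<delta>
        \<longrightarrow> (\<Sum>(s, t)\<in>P. norm (f t - f s)) < \<epsilon>)"

definition C1_regular :: "('a::real_normed_vector \<Rightarrow> 'b::real_normed_vector) \<Rightarrow> bool" where
  "C1_regular f \<longleftrightarrow>
     (\<exists>f' :: 'a \<Rightarrow> ('a \<Rightarrow>\<^sub>L 'b).
        (\<forall>x. (f has_derivative blinfun_apply (f' x)) (at x)) \<and> continuous_on UNIV f')"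

definition solves_control_system ::
  "(real^'n \<Rightarrow> 'p \<Rightarrow> real^'n) \<Rightarrow> (real^'n \<Rightarrow> 'p \<Rightarrow> real^'k^'n) \<Rightarrow> ('p \<Rightarrow> real^'n) \<Rightarrow>
   (real \<Rightarrow> real^'k) \<Rightarrow> 'p \<Rightarrow> (real \<Rightarrow> real^'n) \<Rightarrow> bool" where
  "solves_control_system F0 F x0 u \<theta> x \<longleftrightarrow>
     abs_cont_on_interval 0 1 x \<and> x 0 = x0 \<theta> \<and>
     (AE t in lebesgue_on {0..1}.
        (x has_vector_derivative (F0 (x t) \<theta> + F (x t) \<theta> *v u t)) (at t within {0..1}))"

text \<open>Extensionality fixes the values outside the unit interval, so that uniqueness of the solution
  on the interval makes the description below definite.\<close>

definition trajectory ::
  "(real^'n \<Rightarrow> 'p \<Rightarrow> real^'n) \<Rightarrow> (real^'n \<Rightarrow> 'p \<Rightarrow> real^'k^'n) \<Rightarrow> ('p \<Rightarrow> real^'n) \<Rightarrow>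
   (real \<Rightarrow> real^'k) \<Rightarrow> 'p \<Rightarrow> real \<Rightarrow> real^'n" where
  "trajectory F0 F x0 u \<theta> =
     (THE x. x \<in> extensional {0..1} \<and> solves_control_system F0 F x0 u \<theta> x)"

text \<open>The integral with respect to the measure that puts mass \<open>\<alpha> j\<close> at \<open>\<theta> j\<close>, for \<open>j = 1, \<dots>, N\<close>,
  is written out as a finite sum; the points \<open>\<theta> j\<close> need not be distinct.\<close>

definition ensemble_cost ::
  "(real^'n \<Rightarrow> 'p \<Rightarrow> real^'n) \<Rightarrow> (real^'n \<Rightarrow> 'p \<Rightarrow> real^'k^'n) \<Rightarrow> ('p \<Rightarrow> real^'n) \<Rightarrow>
   (real^'n \<Rightarrow> 'p \<Rightarrow> real) \<Rightarrow> real \<Rightarrow> nat \<Rightarrow> (nat \<Rightarrow> real) \<Rightarrow> (nat \<Rightarrow> 'p) \<Rightarrow>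
   (real \<Rightarrow> real^'k) \<Rightarrow> real" where
  "ensemble_cost F0 F x0 a \<beta> N \<alpha> \<theta> u =
     (\<Sum>j=1..N. \<alpha> j * a (trajectory F0 F x0 u (\<theta> j) 1) (\<theta> j)) + \<beta> / 2 * (L2_unit_norm u)\<^sup>2"

definition L2_local_minimizer ::
  "((real \<Rightarrow> 'a::euclidean_space) \<Rightarrow> real) \<Rightarrow> (real \<Rightarrow> 'a) \<Rightarrow> bool" where
  "L2_local_minimizer J u \<longleftrightarrow>
     u \<in> L2_unit \<and>
     (\<exists>r>0. \<forall>w\<in>L2_unit. L2_unit_norm (\<lambda>t. w t - u t) < r \<longrightarrow> J u \<le> J w)"

end

theory Submission
  imports Defs
begin

text \<open>Compare the trajectory \<open>x\<close> of the minimizer \<open>u\<close> with the trajectory \<open>y\<close> of \<open>u + e v\<close>. With the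
  costate \<open>l\<close> solving the adjoint equation, the derivative of \<open>l \<bullet> (y - x)\<close> only contains the
  effect of \<open>v\<close> and terms of order \<open>o(e)\<close>, because \<open>y - x\<close> is of order \<open>e\<close> by Gronwall; so, after
  dividing by \<open>e\<close>, the variation of the terminal cost converges to \<open>\<integral> l F v\<close> by dominated
  convergence, without passing through the linearised equation. Local minimality
  then makes \<open>\<integral> G \<bullet> v \<ge> 0\<close> for \<open>G = (\<Sum>j. \<alpha>\<^sub>j l\<^sub>j F) + \<beta> u\<close> and all \<open>v\<close>, and \<open>v = - G\<close> forces \<open>G = 0\<close>
  almost everywhere, which is the stationarity condition of the concave quadratic to be maximized.\<close>

section \<open>Absolutely continuous functions\<close>

text \<open>Controls are merely square-integrable, so the dynamics hold only almost everywhere and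
  trajectories are absolutely continuous in the epsilon-delta sense. The estimates, however, are
  made on integrals; hence the fundamental theorem of calculus is established first, in both
  directions. The assumptions on the fields share the work: Lipschitz continuity gives global
  solutions and the bounds that dominate the difference quotients, while differentiability at the
  point \<open>x t\<close> gives their pointwise limit. Continuity of the Jacobians along the
  trajectory makes the coefficient of the adjoint equation integrable in time; as it contains
  \<open>u\<close>, it need not be bounded. Dominated convergence is applied along the sequence
  \<open>e = 1 / (n + 1)\<close>. Positive increments are enough because the direction finally
  inserted, the negative L2 gradient of the cost, is a descent direction. It is an admissible
  variation since \<open>G\<close> is a continuous function plus a multiple of
  \<open>u\<close>.\<close>

definition nonoverlapping :: "real \<Rightarrow> real \<Rightarrow> (real \<times> real) set \<Rightarrow> bool" where
  "nonoverlapping a b P \<longleftrightarrow> finite P \<and> (\<forall>(s, t)\<in>P. a \<le> s \<and> s < t \<and> t \<le> b) \<and>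
     disjoint_family_on (\<lambda>(s, t). {s<..<t}) P"

text \<open>The definition speaks of open intervals, while integrals and measures are taken over the
  closed ones; disjoint open intervals have closures that share at most endpoints.\<close>

lemma nonoverlapping_negligible:
  assumes "nonoverlapping a b P"
  shows "pairwise (\<lambda>i j. negligible ({fst i..snd i} \<inter> {fst j..snd j})) P"
proof (rule pairwiseI)
  fix i j assume ij: "i \<in> P" "j \<in> P" "i \<noteq> j"
  obtain s t s' t' where e: "i = (s,t)" "j = (s',t')" by (metis prod.exhaust)
  have "{s<..<t} \<inter> {s'<..<t'} = {}"
    using assms ij e unfolding nonoverlapping_def disjoint_family_on_def by fastforce
  then have "{s..t} \<inter> {s'..t'} \<subseteq> {s,t,s',t'}"
    by (auto simp: disjoint_iff)
  then show "negligible ({fst i..snd i} \<inter> {fst j..snd j})"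
    unfolding e fst_conv snd_conv by (rule negligible_subset[OF negligible_finite, rotated]) simp
qed

lemma sum_integral_nonoverlapping_le:
  fixes h :: "real \<Rightarrow> real"
  assumes P: "nonoverlapping a b P" and h: "h integrable_on {a..b}" "\<And>x. x \<in> {a..b} \<Longrightarrow> 0 \<le> h x"
  shows "(\<Sum>(s, t)\<in>P. integral {s..t} h) \<le> integral {a..b} h"
proof -
  have sub: "{fst i..snd i} \<subseteq> {a..b}" if "i \<in> P" for i
    using P that unfolding nonoverlapping_def by (force simp: case_prod_beta)
  have "(h has_integral (\<Sum>i\<in>P. integral {fst i..snd i} h)) (\<Union>i\<in>P. {fst i..snd i})"
    using P nonoverlapping_negligible[OF P] sub
    by (intro has_integral_UN integrable_integral integrable_on_subinterval[OF h(1)])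
       (auto simp: nonoverlapping_def)
  then have "(\<Sum>i\<in>P. integral {fst i..snd i} h) \<le> integral {a..b} h"
    using h(2) by (intro has_integral_subset_le[OF UN_least[OF sub] _ integrable_integral[OF h(1)]]) auto
  then show ?thesis by (simp add: case_prod_beta)
qed

lemma abs_cont_on_intervalD:
  assumes "abs_cont_on_interval a b f" "\<epsilon> > 0"
  shows "\<exists>\<delta>>0. \<forall>P. nonoverlapping a b P \<longrightarrow> (\<Sum>(s, t)\<in>P. t - s) < \<delta> \<longrightarrow> (\<Sum>(s, t)\<in>P. norm (f t - f s)) < \<epsilon>"
  using assms unfolding abs_cont_on_interval_def nonoverlapping_def by meson

lemma abs_cont_on_intervalI:
  assumes "\<And>\<epsilon>. \<epsilon> > 0 \<Longrightarrow> \<exists>\<delta>>0. \<forall>P. nonoverlapping a b P \<longrightarrow> (\<Sum>(s, t)\<in>P. t - s) < \<delta> \<longrightarrow> (\<Sum>(s, t)\<in>P. norm (f t - f s)) < \<epsilon>"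
  shows "abs_cont_on_interval a b f"
  using assms unfolding abs_cont_on_interval_def nonoverlapping_def by meson

text \<open>Covers the image of \<open>f\<close> under a map that is Lipschitz on its range, such as
  the exponential of a bounded primitive.\<close>

lemma abs_cont_dominated:
  assumes f: "abs_cont_on_interval a b f"
    and h: "\<And>s t. s \<in> {a..b} \<Longrightarrow> t \<in> {a..b} \<Longrightarrow> norm (h t - h s) \<le> C * norm (f t - f s)"
  shows "abs_cont_on_interval a b h"
proof (rule abs_cont_on_intervalI)
  fix \<epsilon> :: real assume "\<epsilon> > 0"
  \<comment> \<open>\<open>C\<close> may be zero or negative; \<open>D\<close> is a positive upper
    bound of it by which \<open>\<epsilon>\<close> can be divided.\<close>
  define D where "D = \<bar>C\<bar> + 1"
  have D: "D > 0" by (simp add: D_def)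
  obtain \<delta> where \<delta>: "\<delta> > 0"
    "\<forall>P. nonoverlapping a b P \<longrightarrow> (\<Sum>(s, t)\<in>P. t - s) < \<delta> \<longrightarrow> (\<Sum>(s, t)\<in>P. norm (f t - f s)) < \<epsilon> / D"
    using abs_cont_on_intervalD[OF f divide_pos_pos[OF \<open>\<epsilon> > 0\<close> D]] by blast
  show "\<exists>\<delta>>0. \<forall>P. nonoverlapping a b P \<longrightarrow> (\<Sum>(s, t)\<in>P. t - s) < \<delta> \<longrightarrow> (\<Sum>(s, t)\<in>P. norm (h t - h s)) < \<epsilon>"
  proof (intro exI[of _ \<delta>] conjI allI impI \<open>\<delta> > 0\<close>)
    fix P assume P: "nonoverlapping a b P" "(\<Sum>(s, t)\<in>P. t - s) < \<delta>"
    have "(\<Sum>(s, t)\<in>P. norm (h t - h s)) \<le> (\<Sum>(s, t)\<in>P. D * norm (f t - f s))"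
    proof (rule sum_mono, clarify)
      fix s t assume "(s, t) \<in> P"
      then have "s \<in> {a..b}" "t \<in> {a..b}" using P unfolding nonoverlapping_def by auto
      then have "norm (h t - h s) \<le> C * norm (f t - f s)" by (rule h)
      also have "\<dots> \<le> D * norm (f t - f s)" by (intro mult_right_mono) (auto simp: D_def)
      finally show "norm (h t - h s) \<le> D * norm (f t - f s)" .
    qed
    also have "\<dots> = D * (\<Sum>(s, t)\<in>P. norm (f t - f s))" by (simp add: sum_distrib_left case_prod_beta)
    also have "\<dots> < \<epsilon>" using \<delta>(2)[rule_format, OF P] D by (simp add: field_simps)
    finally show "(\<Sum>(s, t)\<in>P. norm (h t - h s)) < \<epsilon>" .
  qed
qed

text \<open>Reduces to one function by pairing: the norm of an increment of \<open>(f, g)\<close>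
  bounds both increments. Differences and inner products of absolutely continuous functions satisfy
  such an estimate.\<close>

lemma abs_cont_dominated2:
  assumes f: "abs_cont_on_interval a b f" and g: "abs_cont_on_interval a b g"
    and h: "\<And>s t. s \<in> {a..b} \<Longrightarrow> t \<in> {a..b} \<Longrightarrow> norm (h t - h s) \<le> C * (norm (f t - f s) + norm (g t - g s))"
  shows "abs_cont_on_interval a b h"
proof -
  have "abs_cont_on_interval a b (\<lambda>t. (f t, g t))"
  proof (rule abs_cont_on_intervalI)
    fix \<epsilon> :: real assume "\<epsilon> > 0"
    obtain \<delta>1 where \<delta>1: "\<delta>1 > 0"
      "\<forall>P. nonoverlapping a b P \<longrightarrow> (\<Sum>(s, t)\<in>P. t - s) < \<delta>1 \<longrightarrow> (\<Sum>(s, t)\<in>P. norm (f t - f s)) < \<epsilon> / 2"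
      using abs_cont_on_intervalD[OF f half_gt_zero[OF \<open>\<epsilon> > 0\<close>]] by blast
    obtain \<delta>2 where \<delta>2: "\<delta>2 > 0"
      "\<forall>P. nonoverlapping a b P \<longrightarrow> (\<Sum>(s, t)\<in>P. t - s) < \<delta>2 \<longrightarrow> (\<Sum>(s, t)\<in>P. norm (g t - g s)) < \<epsilon> / 2"
      using abs_cont_on_intervalD[OF g half_gt_zero[OF \<open>\<epsilon> > 0\<close>]] by blast
    show "\<exists>\<delta>>0. \<forall>P. nonoverlapping a b P \<longrightarrow> (\<Sum>(s, t)\<in>P. t - s) < \<delta> \<longrightarrow>
        (\<Sum>(s, t)\<in>P. norm ((f t, g t) - (f s, g s))) < \<epsilon>"
    proof (intro exI[of _ "min \<delta>1 \<delta>2"] conjI allI impI)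
      fix P assume P: "nonoverlapping a b P" "(\<Sum>(s, t)\<in>P. t - s) < min \<delta>1 \<delta>2"
      have "(\<Sum>(s, t)\<in>P. norm ((f t, g t) - (f s, g s))) \<le> (\<Sum>(s, t)\<in>P. norm (f t - f s) + norm (g t - g s))"
        by (rule sum_mono) (auto simp: norm_Pair intro: sqrt_sum_squares_le_sum)
      also have "\<dots> = (\<Sum>(s, t)\<in>P. norm (f t - f s)) + (\<Sum>(s, t)\<in>P. norm (g t - g s))"
        by (simp add: sum.distrib case_prod_beta)
      also have "\<dots> < \<epsilon>" using \<delta>1(2)[rule_format, OF P(1)] \<delta>2(2)[rule_format, OF P(1)] P(2) by simp
      finally show "(\<Sum>(s, t)\<in>P. norm ((f t, g t) - (f s, g s))) < \<epsilon>" .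
    qed (use \<delta>1 \<delta>2 in auto)
  qed
  then show ?thesis
  proof (rule abs_cont_dominated[where C = "2 * \<bar>C\<bar>"])
    fix s t assume st: "s \<in> {a..b}" "t \<in> {a..b}"
    have le: "norm (f t - f s) \<le> norm ((f t, g t) - (f s, g s))" "norm (g t - g s) \<le> norm ((f t, g t) - (f s, g s))"
      by (auto simp: norm_Pair)
    have "norm (h t - h s) \<le> C * (norm (f t - f s) + norm (g t - g s))" using h st .
    also have "\<dots> \<le> \<bar>C\<bar> * (norm (f t - f s) + norm (g t - g s))" by (intro mult_right_mono) auto
    also have "\<dots> \<le> \<bar>C\<bar> * (2 * norm ((f t, g t) - (f s, g s)))" using le by (intro mult_left_mono) auto
    finally show "norm (h t - h s) \<le> 2 * \<bar>C\<bar> * norm ((f t, g t) - (f s, g s))" by simp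
  qed
qed

lemma abs_cont_imp_continuous_on:
  assumes "abs_cont_on_interval a b f"
  shows "continuous_on {a..b} f"
  unfolding continuous_on_iff
proof (intro ballI allI impI)
  fix x e :: real assume x: "x \<in> {a..b}" and "e > 0"
  obtain \<delta> where \<delta>: "\<delta> > 0"
    "\<forall>P. nonoverlapping a b P \<longrightarrow> (\<Sum>(s, t)\<in>P. t - s) < \<delta> \<longrightarrow> (\<Sum>(s, t)\<in>P. norm (f t - f s)) < e"
    using abs_cont_on_intervalD[OF assms \<open>e > 0\<close>] by blast
  \<comment> \<open>Absolute continuity is used for a family that consists of a single
    interval.\<close>
  have *: "norm (f t - f s) < e" if "s \<in> {a..b}" "t \<in> {a..b}" "s < t" "t - s < \<delta>" for s t
    using \<delta>(2)[rule_format, of "{(s,t)}"] that by (auto simp: nonoverlapping_def disjoint_family_on_def)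
  show "\<exists>d>0. \<forall>x'\<in>{a..b}. dist x' x < d \<longrightarrow> dist (f x') (f x) < e"
  proof (intro exI[of _ \<delta>] conjI ballI impI \<open>\<delta> > 0\<close>)
    fix y assume "y \<in> {a..b}" "dist y x < \<delta>"
    then show "dist (f y) (f x) < e"
      using *[of x y] *[of y x] x \<open>e > 0\<close>
      by (cases x y rule: linorder_cases) (auto simp: dist_real_def dist_norm norm_minus_commute)
  qed
qed

text \<open>Truncating \<open>norm (g x)\<close> at height \<open>k\<close> splits the integral over
  a family of intervals: the truncated part is at most \<open>k\<close> times the total length, and
  the excess has a small integral over all of \<open>{a..b}\<close>, uniformly in the
  family.\<close>

lemma abs_cont_indefinite_integral:
  fixes g :: "real \<Rightarrow> 'a::euclidean_space"
  assumes g: "g absolutely_integrable_on {a..b}"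
  shows "abs_cont_on_interval a b (\<lambda>t. integral {a..t} g)"
proof (rule abs_cont_on_intervalI)
  fix \<epsilon> :: real assume "\<epsilon> > 0"
  define h where "h x = norm (g x)" for x
  define f where "f k x = min (h x) (real k)" for k :: nat and x
  have h: "h absolutely_integrable_on {a..b}" unfolding h_def by (rule absolutely_integrable_norm[OF g, unfolded o_def])
  then have hi: "h integrable_on {a..b}" by (simp add: absolutely_integrable_on_def)
  have f: "f k integrable_on {a..b}" for k
    unfolding f_def
    using absolutely_integrable_min[OF h, of "\<lambda>_. real k"]
    by (auto simp: absolutely_integrable_on_def)
  have "(\<lambda>k. integral {a..b} (f k)) \<longlonglongrightarrow> integral {a..b} h"
  proof (rule dominated_convergence(2)[OF f hi])
    fix x
    show "(\<lambda>k. f k x) \<longlonglongrightarrow> h x"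
    proof (rule tendsto_eventually)
      obtain n where "h x \<le> real n" using real_arch_simple by blast
      then show "\<forall>\<^sub>F k in sequentially. f k x = h x"
        unfolding eventually_sequentially f_def by (intro exI[of _ n]) auto
    qed
  qed (auto simp: f_def h_def)
  then have "\<forall>\<^sub>F k in sequentially. integral {a..b} (f k) > integral {a..b} h - \<epsilon> / 2"
    using \<open>\<epsilon> > 0\<close> by (intro order_tendstoD) auto
  then obtain k where k: "integral {a..b} (f k) > integral {a..b} h - \<epsilon> / 2"
    by (auto simp: eventually_sequentially)
  \<comment> \<open>One half of \<open>\<epsilon>\<close> is spent on the truncated part, the other
    on the excess; \<open>real k + 1\<close> keeps the quotient meaningful for
    \<open>k = 0\<close>.\<close>
  define \<delta> where "\<delta> = \<epsilon> / (2 * (real k + 1))"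
  have \<delta>: "\<delta> > 0" "real k * \<delta> \<le> \<epsilon> / 2" using \<open>\<epsilon> > 0\<close> by (auto simp: \<delta>_def field_simps)
  show "\<exists>\<delta>>0. \<forall>P. nonoverlapping a b P \<longrightarrow> (\<Sum>(s, t)\<in>P. t - s) < \<delta> \<longrightarrow>
     (\<Sum>(s, t)\<in>P. norm (integral {a..t} g - integral {a..s} g)) < \<epsilon>"
  proof (intro exI[of _ \<delta>] conjI allI impI \<delta>(1))
    fix P assume P: "nonoverlapping a b P" "(\<Sum>(s, t)\<in>P. t - s) < \<delta>"
    have "(\<Sum>(s, t)\<in>P. norm (integral {a..t} g - integral {a..s} g)) \<le>
        (\<Sum>(s, t)\<in>P. integral {s..t} (\<lambda>x. h x - f k x) + real k * (t - s))"
    proof (rule sum_mono, clarify)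
      fix s t assume "(s, t) \<in> P"
      then have st: "a \<le> s" "s < t" "t \<le> b" using P unfolding nonoverlapping_def by auto
      have gi: "g integrable_on {a..b}" using g by (simp add: absolutely_integrable_on_def)
      have int: "h integrable_on {s..t}" "f k integrable_on {s..t}" "g integrable_on {s..t}" "g integrable_on {a..t}"
        using st by (auto intro: integrable_on_subinterval[OF hi] integrable_on_subinterval[OF f]
            integrable_on_subinterval[OF gi])
      have "integral {a..t} g = integral {a..s} g + integral {s..t} g"
        using st int by (intro Henstock_Kurzweil_Integration.integral_combine[symmetric]) auto
      then have "norm (integral {a..t} g - integral {a..s} g) = norm (integral {s..t} g)"
        by simp
      also have "\<dots> \<le> integral {s..t} h"
        using int by (intro integral_norm_bound_integral) (auto simp: h_def)
      also have "\<dots> = integral {s..t} (\<lambda>x. h x - f k x) + integral {s..t} (f k)"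
        using int by (simp add: integral_diff)
      also have "integral {s..t} (f k) \<le> integral {s..t} (\<lambda>x. real k)"
        using int by (intro integral_le) (auto simp: f_def)
      also have "\<dots> = real k * (t - s)" using st by simp
      finally show "norm (integral {a..t} g - integral {a..s} g) \<le>
          integral {s..t} (\<lambda>x. h x - f k x) + real k * (t - s)" by simp
    qed
    also have "\<dots> = (\<Sum>(s, t)\<in>P. integral {s..t} (\<lambda>x. h x - f k x)) + real k * (\<Sum>(s, t)\<in>P. t - s)"
      by (simp add: sum.distrib sum_distrib_left case_prod_beta)
    also have "(\<Sum>(s, t)\<in>P. integral {s..t} (\<lambda>x. h x - f k x)) \<le> integral {a..b} (\<lambda>x. h x - f k x)"
      by (rule sum_integral_nonoverlapping_le[OF P(1) integrable_diff[OF hi f]]) (simp add: f_def)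
    also have "\<dots> < \<epsilon> / 2" using hi f k by (simp add: integral_diff)
    also have "real k * (\<Sum>(s, t)\<in>P. t - s) \<le> \<epsilon> / 2"
      using P(2) \<delta> mult_left_mono[of "(\<Sum>(s, t)\<in>P. t - s)" \<delta> "real k"] by auto
    finally show "(\<Sum>(s, t)\<in>P. norm (integral {a..t} g - integral {a..s} g)) < \<epsilon>" by simp
  qed
qed

text \<open>Tags in the exceptional set are confined by the gauge to an open set of small measure,
  where absolute continuity bounds the increments of \<open>f\<close>; the other tags are handled by the
  definition of the derivative.\<close>

lemma abs_cont_has_integral:
  fixes f :: "real \<Rightarrow> 'a::euclidean_space"
  assumes ac: "abs_cont_on_interval a b f" and "a \<le> b" and N: "negligible N"
    and deriv: "\<And>t. t \<in> {a..b} - N \<Longrightarrow> (f has_vector_derivative g t) (at t within {a..b})"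
  shows "(g has_integral f b - f a) {a..b}"
proof -
  \<comment> \<open>With the value zero on \<open>N\<close>, a term of the Riemann sum whose tag
    lies in \<open>N\<close> leaves only an increment of \<open>f\<close>. The change on a
    negligible set is undone at the end.\<close>
  define g' where "g' t = (if t \<in> N then 0 else g t)" for t
  have "(g' has_integral f b - f a) {a..b}"
    unfolding has_integral_real
  proof (intro allI impI)
    fix e :: real assume "e > 0"
    obtain \<delta> where \<delta>: "\<delta> > 0"
      "\<forall>P. nonoverlapping a b P \<longrightarrow> (\<Sum>(s, t)\<in>P. t - s) < \<delta> \<longrightarrow> (\<Sum>(s, t)\<in>P. norm (f t - f s)) < e / 2"
      using abs_cont_on_intervalD[OF ac half_gt_zero[OF \<open>e > 0\<close>]] by blast
    obtain U where U: "open U" "N \<subseteq> U" "U \<in> lmeasurable" "measure lebesgue U < \<delta>"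
    proof -
      obtain T where T: "open T" "N \<subseteq> T" "T - N \<in> lmeasurable" "emeasure lebesgue (T - N) < ennreal \<delta>"
        using sets_lebesgue_outer_open[OF negligible_imp_sets[OF N] \<delta>(1)] by blast
      have "T = (T - N) \<union> N" using T by blast
      then have "T \<in> lmeasurable" using fmeasurable.Un[OF T(3) negligible_imp_measurable[OF N]] by simp
      moreover have "measure lebesgue T = measure lebesgue (T - N)"
      proof -
        have "negligible (sym_diff (T - N) T)" by (rule negligible_subset[OF N]) auto
        then show ?thesis by (rule measure_negligible_symdiff[OF T(3)])
      qed
      moreover have "measure lebesgue (T - N) < \<delta>"
        using T(3,4) \<delta>(1) by (simp add: emeasure_eq_measure2 ennreal_less_iff)
      ultimately show ?thesis using that T by metis
    qed
    \<comment> \<open>Errors of relative size \<open>\<eta>\<close> add up to at most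
      \<open>\<eta> * (b - a)\<close> over a division; the added 1 makes this strictly less than
      \<open>e / 2\<close> and admits \<open>a = b\<close>.\<close>
    define \<eta> where "\<eta> = e / (2 * (b - a + 1))"
    have \<eta>: "\<eta> > 0" "\<eta> * (b - a) < e / 2"
      using \<open>e > 0\<close> \<open>a \<le> b\<close> by (auto simp: \<eta>_def field_simps)
    have "\<exists>d>0. \<forall>y\<in>{a..b}. \<bar>y - t\<bar> < d \<longrightarrow> norm (f y - f t - (y - t) *\<^sub>R g t) \<le> \<eta> * \<bar>y - t\<bar>"
      if "t \<in> {a..b} - N" for t
      using deriv[OF that] \<eta>(1) unfolding has_vector_derivative_def has_derivative_within_alt real_norm_def by blast
    then obtain d where d: "\<And>t. t \<in> {a..b} - N \<Longrightarrow> d t > 0"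
      "\<And>t y. t \<in> {a..b} - N \<Longrightarrow> y \<in> {a..b} \<Longrightarrow> \<bar>y - t\<bar> < d t \<Longrightarrow>
         norm (f y - f t - (y - t) *\<^sub>R g t) \<le> \<eta> * \<bar>y - t\<bar>"
      by metis
    define \<gamma> where "\<gamma> t = (if t \<in> N then U else if t \<in> {a..b} then ball t (d t) else UNIV)" for t
    have "gauge \<gamma>" unfolding gauge_def \<gamma>_def using U d(1) by auto
    show "\<exists>\<gamma>. gauge \<gamma> \<and> (\<forall>p. p tagged_division_of {a..b} \<and> \<gamma> fine p \<longrightarrow>
        norm ((\<Sum>(x,k)\<in>p. measure lborel k *\<^sub>R g' x) - (f b - f a)) < e)"
    proof (intro exI[of _ \<gamma>] conjI allI impI \<open>gauge \<gamma>\<close>, elim conjE)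
      fix p assume p: "p tagged_division_of {a..b}" and fine: "\<gamma> fine p"
      note tag = tagged_division_ofD[OF p]
      \<comment> \<open>Writing the intervals as \<open>{Inf k..Sup k}\<close> makes the endpoints
        functions of \<open>k\<close>, the form in which the telescoping sum
        \<open>additive_tagged_division_1\<close> expresses \<open>f b - f a\<close>.\<close>
      have ivk: "k = {Inf k..Sup k}" and ivl: "x \<in> {Inf k..Sup k} \<and> a \<le> Inf k \<and> Inf k \<le> Sup k \<and> Sup k \<le> b"
        if "(x, k) \<in> p" for x k
      proof -
        obtain u v where "k = cbox u v" using tag(4)[OF \<open>(x, k) \<in> p\<close>] by blast
        then have k: "k = {u..v}" by simp
        with tag(2)[OF that] have "u \<le> v" by auto
        then have uv: "Inf k = u" "Sup k = v" by (simp_all add: k)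
        show "k = {Inf k..Sup k}" by (simp only: uv) (rule k)
        show "x \<in> {Inf k..Sup k} \<and> a \<le> Inf k \<and> Inf k \<le> Sup k \<and> Sup k \<le> b"
          using tag(2)[OF that] tag(3)[OF that] \<open>u \<le> v\<close> unfolding uv k by auto
      qed
      define p1 where "p1 = {i \<in> p. fst i \<notin> N}"
      define p2 where "p2 = {i \<in> p. fst i \<in> N}"
      define \<phi> where "\<phi> = (\<lambda>(x, k). measure lborel k *\<^sub>R g' x - (f (Sup k) - f (Inf k)))"
      have "p1 \<subseteq> p" "p2 \<subseteq> p" and pp: "p = p1 \<union> p2" "p1 \<inter> p2 = {}"
        unfolding p1_def p2_def by blast+
      then have fin: "finite p1" "finite p2" using tag(1) finite_subset by blast+
      have "norm (sum \<phi> p1) \<le> (\<Sum>(x,k)\<in>p1. \<eta> * measure lborel k)"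
      proof (rule sum_norm_le)
        fix i assume "i \<in> p1"
        obtain x k where i: "i = (x, k)" by force
        have xk: "(x, k) \<in> p" "x \<notin> N" using \<open>i \<in> p1\<close> i by (auto simp: p1_def)
        define u v where "u = Inf k" and "v = Sup k"
        have iv: "x \<in> {u..v}" "k = {u..v}" "a \<le> u" "u \<le> v" "v \<le> b"
          unfolding u_def v_def using ivl[OF xk(1)] ivk[OF xk(1)] by blast+
        have uv: "Inf k = u" "Sup k = v" by (simp_all add: u_def v_def)
        have "k \<subseteq> \<gamma> x" using fine xk unfolding fine_def by blast
        moreover have "x \<in> {a..b}" using iv by auto
        ultimately have "{u..v} \<subseteq> ball x (d x)" using xk iv by (auto simp: \<gamma>_def)
        moreover have "u \<in> {u..v}" "v \<in> {u..v}" using iv by auto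
        ultimately have "u \<in> ball x (d x)" "v \<in> ball x (d x)" by blast+
        then have le: "norm (f v - f x - (v - x) *\<^sub>R g x) \<le> \<eta> * \<bar>v - x\<bar>" "norm (f u - f x - (u - x) *\<^sub>R g x) \<le> \<eta> * \<bar>u - x\<bar>"
          using d(2)[of x v] d(2)[of x u] xk iv by (auto simp: dist_real_def abs_minus_commute)
        have "\<phi> (x, k) = (v - u) *\<^sub>R g x - (f v - f u)"
          using iv(2,4) xk by (simp add: \<phi>_def g'_def uv)
        \<comment> \<open>The tag lies between \<open>u\<close> and \<open>v\<close>, so the errors
          towards the two endpoints add up to \<open>\<eta>\<close> times the length of the
          interval.\<close>
        also have "\<dots> = (f u - f x - (u - x) *\<^sub>R g x) - (f v - f x - (v - x) *\<^sub>R g x)"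
          by (simp add: algebra_simps)
        also have "norm \<dots> \<le> norm (f u - f x - (u - x) *\<^sub>R g x) + norm (f v - f x - (v - x) *\<^sub>R g x)"
          by (rule norm_triangle_ineq4)
        also have "\<dots> \<le> \<eta> * \<bar>u - x\<bar> + \<eta> * \<bar>v - x\<bar>" by (intro add_mono le)
        also have "\<dots> = \<eta> * measure lborel k"
          using iv by (simp add: algebra_simps abs_if)
        finally have "norm (\<phi> (x, k)) \<le> \<eta> * measure lborel k" .
        then show "norm (\<phi> i) \<le> (case i of (x, k) \<Rightarrow> \<eta> * measure lborel k)" by (simp add: i)
      qed
      also have "\<dots> \<le> (\<Sum>(x,k)\<in>p. \<eta> * measure lborel k)"
        using \<eta> by (intro sum_mono2[OF tag(1) \<open>p1 \<subseteq> p\<close>]) auto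
      also have "\<dots> = \<eta> * (b - a)"
      proof -
        have "(\<Sum>(x,k)\<in>p. measure lborel k) = measure lborel {a..b}"
          using additive_content_tagged_division[of p a b] p by simp
        then show ?thesis using \<open>a \<le> b\<close> by (simp add: sum_distrib_left[symmetric] case_prod_beta)
      qed
      also have "\<dots> < e / 2" by (rule \<eta>)
      finally have 1: "norm (sum \<phi> p1) < e / 2" .
      \<comment> \<open>Degenerate intervals carry a zero increment of \<open>f\<close>, and
        \<open>nonoverlapping\<close> demands \<open>s < t\<close>, so they are split off.\<close>
      define q where "q = {(x, k) \<in> p2. Inf k < Sup k}"
      define E where "E = (\<lambda>(x::real, k::real set). (Inf k, Sup k))"
      have q: "q \<subseteq> p2" "finite q" using fin by (auto simp: q_def intro: finite_subset)
      have qivl: "(x, k) \<in> p \<and> a \<le> Inf k \<and> Inf k < Sup k \<and> Sup k \<le> b \<and> k \<subseteq> U" if "(x, k) \<in> q" for x k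
      proof -
        have "(x, k) \<in> p" "x \<in> N" "Inf k < Sup k" using that by (auto simp: q_def p2_def)
        moreover from this have "k \<subseteq> U" using fine by (fastforce simp: fine_def \<gamma>_def)
        ultimately show ?thesis using ivl[of x k] by blast
      qed
      have dis: "{Inf k<..<Sup k} \<inter> {Inf l<..<Sup l} = {}" if "(x, k) \<in> q" "(y, l) \<in> q" "(x, k) \<noteq> (y, l)" for x k y l
      proof -
        have "interior k \<inter> interior l = {}" using tag(5)[of x k y l] qivl that by blast
        moreover have "interior k = {Inf k<..<Sup k}" "interior l = {Inf l<..<Sup l}"
          using qivl[OF that(1)] qivl[OF that(2)] ivk[of x k] ivk[of y l] interior_atLeastAtMost_real by metis+
        ultimately show ?thesis by simp
      qed
      \<comment> \<open>Two different members of \<open>q\<close> have disjoint and nonempty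
        interiors, so they cannot have the same endpoints; passing to the image under
        \<open>E\<close> therefore loses no term of the sum.\<close>
      have inj: "inj_on E q"
      proof (rule inj_onI, clarify)
        fix x k y l assume kl: "(x, k) \<in> q" "(y, l) \<in> q" "E (x, k) = E (y, l)"
        show "x = y \<and> k = l"
        proof (rule ccontr)
          assume "\<not> (x = y \<and> k = l)"
          then have "{Inf k<..<Sup k} \<inter> {Inf l<..<Sup l} = {}" using dis[OF kl(1,2)] by blast
          then have "{Inf k<..<Sup k} = {}" using kl(3) by (simp add: E_def)
          then show False using qivl[OF kl(1)] by auto
        qed
      qed
      have non: "nonoverlapping a b (E ` q)"
        unfolding nonoverlapping_def
      proof (intro conjI)
        show "\<forall>(s, t)\<in>E ` q. a \<le> s \<and> s < t \<and> t \<le> b"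
          using qivl by (fastforce simp: E_def)
        show "disjoint_family_on (\<lambda>(s, t). {s<..<t}) (E ` q)"
          unfolding disjoint_family_on_def
        proof (intro ballI impI)
          fix m n assume mn: "m \<in> E ` q" "n \<in> E ` q" "m \<noteq> n"
          then obtain x k y l where *: "(x, k) \<in> q" "m = E (x, k)" "(y, l) \<in> q" "n = E (y, l)" by auto
          then have "(x, k) \<noteq> (y, l)" using mn(3) by auto
          from dis[OF *(1,3) this]
          show "(case m of (s, t) \<Rightarrow> {s<..<t}) \<inter> (case n of (s, t) \<Rightarrow> {s<..<t}) = {}"
            by (simp add: *(2,4) E_def)
        qed
      qed (use q in simp)
      have "(\<Sum>(s, t)\<in>E ` q. t - s) = (\<Sum>i\<in>E ` q. measure lebesgue {fst i..snd i})"
        using qivl by (intro sum.cong) (auto simp: E_def less_imp_le)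
      also have "\<dots> = measure lebesgue (\<Union>i\<in>E ` q. {fst i..snd i})"
        using nonoverlapping_negligible[OF non] q by (intro measure_negligible_finite_Union_image[symmetric]) auto
      also have "\<dots> \<le> measure lebesgue U"
      proof (rule measure_mono_fmeasurable)
        show "(\<Union>i\<in>E ` q. {fst i..snd i}) \<subseteq> U"
        proof (rule UN_least)
          fix i assume "i \<in> E ` q"
          then obtain x k where "(x, k) \<in> q" "i = E (x, k)" by auto
          then show "{fst i..snd i} \<subseteq> U" using qivl[of x k] ivk[of x k] by (simp add: E_def)
        qed
      qed (use q U in auto)
      also have "\<dots> < \<delta>" by (rule U)
      finally have "(\<Sum>(s, t)\<in>E ` q. norm (f t - f s)) < e / 2"
        using \<delta>(2) non by blast
      then have "(\<Sum>(x, k)\<in>q. norm (f (Sup k) - f (Inf k))) < e / 2"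
        unfolding sum.reindex[OF inj] by (simp add: E_def case_prod_beta)
      moreover have "(\<Sum>(x, k)\<in>p2. norm (f (Sup k) - f (Inf k))) = (\<Sum>(x, k)\<in>q. norm (f (Sup k) - f (Inf k)))"
      proof (rule sum.mono_neutral_right[OF fin(2) q(1)], rule ballI)
        fix i assume "i \<in> p2 - q"
        moreover obtain x k where i: "i = (x, k)" by force
        ultimately have "(x, k) \<in> p" "\<not> Inf k < Sup k" by (auto simp: p2_def q_def)
        then have "Inf k = Sup k" using ivl[of x k] by auto
        then show "(case i of (x, k) \<Rightarrow> norm (f (Sup k) - f (Inf k))) = 0" by (simp add: i)
      qed
      moreover have "norm (sum \<phi> p2) \<le> (\<Sum>(x, k)\<in>p2. norm (f (Sup k) - f (Inf k)))"
        by (rule sum_norm_le) (auto simp: \<phi>_def g'_def p2_def norm_minus_commute)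
      ultimately have 2: "norm (sum \<phi> p2) < e / 2" by linarith
      have "(\<Sum>(x,k)\<in>p. measure lborel k *\<^sub>R g' x) - (f b - f a) = sum \<phi> p"
        using additive_tagged_division_1[OF \<open>a \<le> b\<close> p, of f]
        by (simp add: \<phi>_def sum_subtractf case_prod_beta)
      also have "\<dots> = sum \<phi> p1 + sum \<phi> p2"
        using fin pp by (simp add: sum.union_disjoint)
      finally show "norm ((\<Sum>(x,k)\<in>p. measure lborel k *\<^sub>R g' x) - (f b - f a)) < e"
        using 1 2 norm_triangle_ineq[of "sum \<phi> p1" "sum \<phi> p2"] by simp
    qed
  qed
  then show ?thesis
    by (rule has_integral_spike[OF N, rotated]) (auto simp: g'_def)
qed

section \<open>Lebesgue differentiation\<close>

text \<open>A point where the derivative fails lies in arbitrarily short intervals on which the Riemann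
  sum and the integral differ by a fixed fraction of the length. A disjoint Vitali subfamily of
  such intervals is a fine partial division, so Henstock's lemma bounds its total length.\<close>

lemma lebesgue_differentiation:
  fixes g :: "real \<Rightarrow> 'a::euclidean_space"
  assumes g: "g integrable_on {a..b}"
  shows "negligible {t \<in> {a..b}. \<not> ((\<lambda>t. integral {a..t} g) has_vector_derivative g t) (at t within {a..b})}"
proof -
  define G where "G t = integral {a..t} g" for t
  \<comment> \<open>At a point of \<open>S n\<close> the linear approximation fails with tolerance
    \<open>1 / (n + 1)\<close> arbitrarily close by. Every failure of the derivative has such a
    tolerance, so countably many of these sets cover the exceptional set.\<close>
  define S where "S n = {t \<in> {a..b}. \<forall>d>0. \<exists>y\<in>{a..b}. \<bar>y - t\<bar> < d \<and>
      norm (G y - G t - (y - t) *\<^sub>R g t) > \<bar>y - t\<bar> / real (Suc n)}" for n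
  have "negligible (S n)" for n
    unfolding negligible_outer_le
  proof (intro allI impI)
    fix e :: real assume "e > 0"
    \<comment> \<open>Henstock's lemma is used with tolerance \<open>c * e\<close>: each selected
      interval has an error above \<open>c\<close> times its length, so the total length stays below
      \<open>e\<close>.\<close>
    define c where "c = 1 / real (Suc n)"
    have "c > 0" by (simp add: c_def)
    obtain \<gamma> where \<gamma>: "gauge \<gamma>"
      "\<And>p. \<lbrakk>p tagged_partial_division_of (cbox a b); \<gamma> fine p\<rbrakk> \<Longrightarrow>
             (\<Sum>(x,k)\<in>p. norm (measure lborel k *\<^sub>R g x - integral k g)) < c * e"
      using Henstock_lemma[of g a b "c * e"] g \<open>e > 0\<close> \<open>c > 0\<close> by auto
    \<comment> \<open>A pair consists of the tag and the other endpoint, which may lie on either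
      side of it; \<open>m\<close> and \<open>r\<close> present the segment as a ball for the Vitali
      covering theorem.\<close>
    define K where "K = {(t, y). t \<in> {a..b} \<and> y \<in> {a..b} \<and> t \<noteq> y \<and> closed_segment t y \<subseteq> \<gamma> t \<and>
        norm (G y - G t - (y - t) *\<^sub>R g t) > c * \<bar>y - t\<bar>}"
    define m where "m = (\<lambda>(t::real, y::real). (t + y) / 2)"
    define r where "r = (\<lambda>(t::real, y::real). \<bar>y - t\<bar> / 2)"
    have cb: "cball (m i) (r i) = closed_segment (fst i) (snd i)" for i
      by (cases i) (auto simp: m_def r_def cball_eq_atLeastAtMost closed_segment_eq_real_ivl abs_if field_simps)
    obtain C where C: "countable C" "C \<subseteq> K"
      "pairwise (\<lambda>i j. disjnt (cball (m i) (r i)) (cball (m j) (r j))) C"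
      "negligible (S n - (\<Union>i\<in>C. cball (m i) (r i)))"
    proof (rule Vitali_covering_theorem_cballs[of K r "S n" m])
      show "0 < r i" if "i \<in> K" for i using that by (auto simp: K_def r_def)
      fix x d :: real assume x: "x \<in> S n" and "0 < d"
      have "open (\<gamma> x)" "x \<in> \<gamma> x" using \<gamma>(1) by (auto simp: gauge_def)
      then obtain d' where d': "d' > 0" "ball x d' \<subseteq> \<gamma> x" using openE by blast
      then have "min d d' > 0" using \<open>0 < d\<close> by simp
      moreover have "\<forall>d>0. \<exists>y\<in>{a..b}. \<bar>y - x\<bar> < d \<and>
          norm (G y - G x - (y - x) *\<^sub>R g x) > \<bar>y - x\<bar> / real (Suc n)"
        using x by (simp add: S_def)
      ultimately obtain y where y: "y \<in> {a..b}" "\<bar>y - x\<bar> < min d d'"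
          "norm (G y - G x - (y - x) *\<^sub>R g x) > \<bar>y - x\<bar> / real (Suc n)"
        by blast
      have "y \<noteq> x" using y(3) by auto
      moreover have "closed_segment x y \<subseteq> ball x d'"
        using y(2) d'(1) by (intro closed_segment_subset) (auto simp: dist_real_def)
      ultimately have "(x, y) \<in> K"
        using y x d' unfolding K_def S_def c_def by (auto simp: field_simps)
      moreover have "x \<in> cball (m (x, y)) (r (x, y))" unfolding cb by simp
      moreover have "r (x, y) < d" using y \<open>0 < d\<close> by (auto simp: r_def)
      ultimately show "\<exists>i. i \<in> K \<and> x \<in> cball (m i) (r i) \<and> r i < d" by blast
    qed
    \<comment> \<open>Henstock's lemma concerns finite partial divisions. The bound \<open>e\<close>
      is the same for all finite subfamilies and hence passes to the countable union.\<close>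
    have fin: "measure lebesgue (\<Union>i\<in>D. cball (m i) (r i)) \<le> e" if D: "D \<subseteq> C" "finite D" for D
    proof -
      define p where "p = (\<lambda>i. (fst i, cball (m i) (r i))) ` D"
      have DK: "D \<subseteq> K" using D C by blast
      have disj: "cball (m i) (r i) \<inter> cball (m j) (r j) = {}" if "i \<in> D" "j \<in> D" "i \<noteq> j" for i j
        using C(3) that D unfolding pairwise_def disjnt_def by blast
      have ne: "fst i \<in> cball (m i) (r i)" for i unfolding cb by simp
      have inj: "inj_on (\<lambda>i. (fst i, cball (m i) (r i))) D"
        by (rule inj_onI) (use disj ne in blast)
      have seg: "closed_segment (fst i) (snd i) \<subseteq> {a..b}" if "i \<in> K" for i
        using that by (intro closed_segment_subset) (auto simp: K_def)
      have tag: "p tagged_partial_division_of (cbox a b)"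
        unfolding tagged_partial_division_of_def
      proof (intro conjI allI impI)
        show "finite p" using D by (simp add: p_def)
        fix x k assume "(x, k) \<in> p"
        then obtain i where i: "i \<in> D" "x = fst i" "k = cball (m i) (r i)" by (auto simp: p_def)
        show "x \<in> k" using i ne by simp
        show "k \<subseteq> cbox a b" using i seg[of i] DK unfolding cb by auto
        show "\<exists>a b. k = cbox a b" unfolding i(3) cball_eq_atLeastAtMost box_real(2)[symmetric] by blast
      next
        fix x1 k1 x2 k2 assume "(x1, k1) \<in> p \<and> (x2, k2) \<in> p \<and> (x1, k1) \<noteq> (x2, k2)"
        then show "interior k1 \<inter> interior k2 = {}"
          using disj interior_subset unfolding p_def by blast
      qed
      have fine: "\<gamma> fine p"
      proof -
        have "closed_segment (fst i) (snd i) \<subseteq> \<gamma> (fst i)" if "i \<in> K" for i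
          using that by (auto simp: K_def)
        then show ?thesis using DK unfolding fine_def p_def cb by blast
      qed
      have key: "c * measure lebesgue (cball (m i) (r i)) \<le>
          norm (measure lborel (cball (m i) (r i)) *\<^sub>R g (fst i) - integral (cball (m i) (r i)) g)" if "i \<in> D" for i
      proof -
        obtain t y where i: "i = (t, y)" by force
        have K: "t \<in> {a..b}" "y \<in> {a..b}" "t \<noteq> y" "norm (G y - G t - (y - t) *\<^sub>R g t) > c * \<bar>y - t\<bar>"
          using that DK i by (auto simp: K_def)
        have comb: "integral {s..s'} g = G s' - G s" if "a \<le> s" "s \<le> s'" "s' \<le> b" for s s'
        proof -
          have "integral {a..s} g + integral {s..s'} g = integral {a..s'} g"
            using that by (intro Henstock_Kurzweil_Integration.integral_combine integrable_on_subinterval[OF g]) auto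
          then show ?thesis by (simp add: G_def algebra_simps)
        qed
        show ?thesis
        proof (cases "t < y")
          case True
          then have "closed_segment t y = {t..y}" "integral {t..y} g = G y - G t"
            using K comb[of t y] by (auto simp: closed_segment_eq_real_ivl)
          then show ?thesis unfolding cb i using K True by (simp add: norm_minus_commute)
        next
          case False
          then have eq: "closed_segment t y = {y..t}" "integral {y..t} g = G t - G y"
            "measure lborel {y..t} = t - y" "measure lebesgue {y..t} = t - y" "\<bar>y - t\<bar> = t - y"
            using K comb[of y t] by (auto simp: closed_segment_eq_real_ivl)
          have eq': "(t - y) *\<^sub>R g t - (G t - G y) = G y - G t - (y - t) *\<^sub>R g t"
            by (simp add: algebra_simps)
          show ?thesis unfolding cb i fst_conv snd_conv eq eq' using K(4) unfolding eq by (rule less_imp_le)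
        qed
      qed
      have "c * measure lebesgue (\<Union>i\<in>D. cball (m i) (r i)) \<le> c * (\<Sum>i\<in>D. measure lebesgue (cball (m i) (r i)))"
        using \<open>c > 0\<close> D by (intro mult_left_mono measure_UNION_le) auto
      also have "\<dots> = (\<Sum>i\<in>D. c * measure lebesgue (cball (m i) (r i)))" by (simp add: sum_distrib_left)
      also have "\<dots> \<le> (\<Sum>i\<in>D. norm (measure lborel (cball (m i) (r i)) *\<^sub>R g (fst i) - integral (cball (m i) (r i)) g))"
        by (intro sum_mono key)
      also have "\<dots> = (\<Sum>(x,k)\<in>p. norm (measure lborel k *\<^sub>R g x - integral k g))"
        unfolding p_def by (subst sum.reindex[OF inj]) simp
      also have "\<dots> < c * e" by (rule \<gamma>(2)[OF tag fine])
      finally show ?thesis using \<open>c > 0\<close> by simp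
    qed
    have U: "(\<Union>i\<in>C. cball (m i) (r i)) \<in> lmeasurable" "measure lebesgue (\<Union>i\<in>C. cball (m i) (r i)) \<le> e"
      using fmeasurable_UN_bound[OF C(1), of "\<lambda>i. cball (m i) (r i)" lebesgue e]
        measure_UN_bound[OF C(1), of "\<lambda>i. cball (m i) (r i)" lebesgue e] fin by auto
    let ?U = "\<Union>i\<in>C. cball (m i) (r i)"
    have "S n \<subseteq> ?U \<union> (S n - ?U)" by blast
    moreover have "?U \<union> (S n - ?U) \<in> lmeasurable"
      using U(1) negligible_imp_measurable[OF C(4)] by (rule fmeasurable.Un)
    moreover have "measure lebesgue (?U \<union> (S n - ?U)) \<le> e"
      using measure_Un_le[of ?U lebesgue "S n - ?U"] U C(4)
      by (simp add: negligible_imp_measure0 negligible_imp_sets fmeasurableD)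
    ultimately show "\<exists>T. S n \<subseteq> T \<and> T \<in> lmeasurable \<and> measure lebesgue T \<le> e" by blast
  qed
  then have "negligible (\<Union>n. S n)" by (intro negligible_countable_Union) auto
  moreover have "{t \<in> {a..b}. \<not> (G has_vector_derivative g t) (at t within {a..b})} \<subseteq> (\<Union>n. S n)"
  proof safe
    fix t assume t: "t \<in> {a..b}" "\<not> (G has_vector_derivative g t) (at t within {a..b})"
    then obtain e where e: "e > 0"
      "\<And>d. d > 0 \<Longrightarrow> \<exists>y\<in>{a..b}. norm (y - t) < d \<and> norm (G y - G t - (y - t) *\<^sub>R g t) > e * norm (y - t)"
      unfolding has_vector_derivative_def has_derivative_within_alt
      by (auto simp: bounded_linear_scaleR_left not_le)
    obtain n where n: "1 / real (Suc n) < e" using nat_approx_posE[OF e(1)] .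
    have "t \<in> S n" unfolding S_def
    proof (intro CollectI conjI allI impI t)
      fix d :: real assume "d > 0"
      then obtain y where y: "y \<in> {a..b}" "\<bar>y - t\<bar> < d" "norm (G y - G t - (y - t) *\<^sub>R g t) > e * \<bar>y - t\<bar>"
        using e(2)[of d] unfolding real_norm_def by blast
      moreover have "\<bar>y - t\<bar> / real (Suc n) \<le> e * \<bar>y - t\<bar>"
        using mult_right_mono[of "1 / real (Suc n)" e "\<bar>y - t\<bar>"] n by simp
      ultimately show "\<exists>y\<in>{a..b}. \<bar>y - t\<bar> < d \<and> \<bar>y - t\<bar> / real (Suc n) < norm (G y - G t - (y - t) *\<^sub>R g t)"
        by (intro bexI[of _ y]) auto
    qed
    then show "t \<in> (\<Union>n. S n)" by blast
  qed
  ultimately show ?thesis unfolding G_def by (rule negligible_subset)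
qed

section \<open>Caratheodory differential equations\<close>

text \<open>Since \<open>exp\<close> is Lipschitz on the bounded range of the primitive of
  \<open>l\<close>, the exponential is absolutely continuous, and the chain rule holds wherever that
  primitive has derivative \<open>l\<close>. The factor 2 is the source of the 1/2 that is absorbed
  in \<open>gronwall\<close> and of the contraction factor in the existence proof.\<close>

lemma has_integral_exp_weight:
  fixes l :: "real \<Rightarrow> real"
  assumes l: "l absolutely_integrable_on {a..b}" and "a \<le> b"
  shows "((\<lambda>s. 2 * l s * exp (2 * integral {a..s} l)) has_integral exp (2 * integral {a..b} l) - 1) {a..b}"
proof -
  define I where "I t = integral {a..t} l" for t
  have ac: "abs_cont_on_interval a b I"
    unfolding I_def by (rule abs_cont_indefinite_integral[OF l])
  have li: "l integrable_on {a..b}" using l by (simp add: absolutely_integrable_on_def)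
  have "bounded (I ` {a..b})"
    using abs_cont_imp_continuous_on[OF ac] by (intro compact_imp_bounded compact_continuous_image) auto
  then obtain M where "\<forall>y\<in>I ` {a..b}. norm y \<le> M" unfolding bounded_iff by blast
  then have M: "\<bar>I t\<bar> \<le> M" if "t \<in> {a..b}" for t using that by auto
  have "abs_cont_on_interval a b (\<lambda>t. exp (2 * I t))"
  proof (rule abs_cont_dominated[OF ac])
    fix s t assume "s \<in> {a..b}" "t \<in> {a..b}"
    then have st: "2 * I s \<in> {-2*M..2*M}" "2 * I t \<in> {-2*M..2*M}" using M[of s] M[of t] by auto
    have "norm (exp (2 * I t) - exp (2 * I s)) \<le> exp (2 * M) * norm (2 * I t - 2 * I s)"
    proof (rule field_differentiable_bound[where f' = exp, OF _ _ _ st(2) st(1)])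
      show "norm (exp z) \<le> exp (2 * M)" if "z \<in> {-2*M..2*M}" for z using that by simp
    qed (auto intro: derivative_eq_intros)
    also have "\<dots> = 2 * exp (2 * M) * norm (I t - I s)" by (simp add: abs_if)
    finally show "norm (exp (2 * I t) - exp (2 * I s)) \<le> 2 * exp (2 * M) * norm (I t - I s)" .
  qed
  moreover have "((\<lambda>t. exp (2 * I t)) has_vector_derivative 2 * l t * exp (2 * I t)) (at t within {a..b})"
    if "t \<in> {a..b} - {t \<in> {a..b}. \<not> (I has_vector_derivative l t) (at t within {a..b})}" for t
  proof -
    have "(I has_field_derivative l t) (at t within {a..b})"
      using that by (simp add: has_real_derivative_iff_has_vector_derivative)
    then have "((\<lambda>t. exp (2 * I t)) has_field_derivative 2 * l t * exp (2 * I t)) (at t within {a..b})"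
      by (auto intro!: derivative_eq_intros)
    then show ?thesis by (simp add: has_real_derivative_iff_has_vector_derivative)
  qed
  ultimately have "((\<lambda>s. 2 * l s * exp (2 * I s)) has_integral exp (2 * I b) - exp (2 * I a)) {a..b}"
    using \<open>a \<le> b\<close> lebesgue_differentiation[OF li] unfolding I_def[symmetric] by (intro abs_cont_has_integral)
  then show ?thesis unfolding I_def by simp
qed

lemma continuous_times_absolutely_integrable:
  fixes l :: "real \<Rightarrow> real" and g :: "real \<Rightarrow> 'a::euclidean_space"
  assumes "l absolutely_integrable_on {a..b}" "continuous_on {a..b} g"
  shows "(\<lambda>s. l s *\<^sub>R g s) absolutely_integrable_on {a..b}"
proof -
  have "(\<lambda>s. (\<lambda>x y. y *\<^sub>R x) (g s) (l s)) absolutely_integrable_on {a..b}"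
  proof (rule absolutely_integrable_bounded_measurable_product[where h = "\<lambda>x y. y *\<^sub>R x"])
    show "bilinear (\<lambda>(x::'a) y. y *\<^sub>R x)" by (auto simp: bilinear_def linear_iff algebra_simps)
    show "g \<in> borel_measurable (lebesgue_on {a..b})"
      using assms(2) by (intro continuous_imp_measurable_on_sets_lebesgue) auto
    show "bounded (g ` {a..b})" using assms(2) by (intro compact_imp_bounded compact_continuous_image) auto
  qed (use assms in auto)
  then show ?thesis by simp
qed

lemma gronwall:
  fixes l \<phi> :: "real \<Rightarrow> real"
  assumes l: "l absolutely_integrable_on {a..b}" "\<And>s. s \<in> {a..b} \<Longrightarrow> 0 \<le> l s"
    and \<phi>: "continuous_on {a..b} \<phi>" "\<And>s. s \<in> {a..b} \<Longrightarrow> 0 \<le> \<phi> s"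
    and le: "\<And>t. t \<in> {a..b} \<Longrightarrow> \<phi> t \<le> c + integral {a..t} (\<lambda>s. l s * \<phi> s)"
    and t: "t \<in> {a..b}"
  shows "\<phi> t \<le> 2 * c * exp (2 * integral {a..t} l)"
proof -
  define I where "I t = integral {a..t} l" for t
  have li: "l integrable_on {a..b}" using l by (simp add: absolutely_integrable_on_def)
  have contI: "continuous_on {a..b} I"
    unfolding I_def by (rule indefinite_integral_continuous_1[OF li])
  have ab: "a \<le> b" "a \<in> {a..b}" using t by auto
  obtain \<tau> where \<tau>: "\<tau> \<in> {a..b}" "\<And>s. s \<in> {a..b} \<Longrightarrow> exp (- 2 * I s) * \<phi> s \<le> exp (- 2 * I \<tau>) * \<phi> \<tau>"
  proof -
    have "continuous_on {a..b} (\<lambda>s. exp (- 2 * I s) * \<phi> s)" by (intro continuous_intros contI \<phi>(1))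
    then have "\<exists>\<tau>\<in>{a..b}. \<forall>s\<in>{a..b}. exp (- 2 * I s) * \<phi> s \<le> exp (- 2 * I \<tau>) * \<phi> \<tau>"
      using ab by (intro continuous_attains_sup) auto
    then show ?thesis using that by blast
  qed
  define m where "m = exp (- 2 * I \<tau>) * \<phi> \<tau>"
  have m: "m \<ge> 0" using \<phi>(2)[OF \<tau>(1)] by (simp add: m_def)
  have bd: "\<phi> s \<le> m * exp (2 * I s)" if "s \<in> {a..b}" for s
    using \<tau>(2)[OF that] unfolding m_def[symmetric] by (simp add: exp_minus field_simps)
  have c: "c \<ge> 0" using le[OF ab(2)] \<phi>(2)[OF ab(2)] by simp
  have I\<tau>: "I \<tau> \<ge> 0"
    unfolding I_def using l(2) \<tau>(1) by (intro integral_nonneg integrable_on_subinterval[OF li]) auto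
  have sub: "{a..\<tau>} \<subseteq> {a..b}" using \<tau> by auto
  have w: "((\<lambda>s. 2 * l s * exp (2 * I s)) has_integral exp (2 * I \<tau>) - 1) {a..\<tau>}"
    unfolding I_def using \<tau>(1) by (intro has_integral_exp_weight absolutely_integrable_on_subinterval[OF l(1) sub]) auto
  have "\<phi> \<tau> \<le> c + integral {a..\<tau>} (\<lambda>s. l s * \<phi> s)" by (rule le[OF \<tau>(1)])
  also have "integral {a..\<tau>} (\<lambda>s. l s * \<phi> s) \<le> integral {a..\<tau>} (\<lambda>s. m / 2 * (2 * l s * exp (2 * I s)))"
  proof (rule integral_le)
    have "(\<lambda>s. l s *\<^sub>R \<phi> s) absolutely_integrable_on {a..\<tau>}"
      by (intro continuous_times_absolutely_integrable absolutely_integrable_on_subinterval[OF l(1) sub]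
          continuous_on_subset[OF \<phi>(1) sub])
    then show "(\<lambda>s. l s * \<phi> s) integrable_on {a..\<tau>}" by (simp add: absolutely_integrable_on_def)
    show "(\<lambda>s. m / 2 * (2 * l s * exp (2 * I s))) integrable_on {a..\<tau>}"
      by (rule has_integral_integrable[OF has_integral_mult_right[OF w]])
    fix s assume "s \<in> {a..\<tau>}"
    then have s: "s \<in> {a..b}" using sub by blast
    show "l s * \<phi> s \<le> m / 2 * (2 * l s * exp (2 * I s))"
      using mult_left_mono[OF bd[OF s] l(2)[OF s]] by (simp add: mult_ac)
  qed
  also have "\<dots> = m / 2 * (exp (2 * I \<tau>) - 1)"
    using integral_unique[OF has_integral_mult_right[OF w, of "m / 2"]] .
  finally have "\<phi> \<tau> \<le> c + m / 2 * (exp (2 * I \<tau>) - 1)" by simp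
  moreover have "\<phi> \<tau> = m * exp (2 * I \<tau>)" by (simp add: m_def exp_minus)
  ultimately have "m * exp (2 * I \<tau>) \<le> 2 * c - m" by (simp add: algebra_simps)
  then have "m * exp (2 * I \<tau>) \<le> 2 * c * 1" using m by simp
  also have "\<dots> \<le> 2 * c * exp (2 * I \<tau>)" using c I\<tau> by (intro mult_left_mono) auto
  finally have "m \<le> 2 * c" by simp
  then have "m * exp (2 * I t) \<le> 2 * c * exp (2 * I t)" by (intro mult_right_mono) auto
  with bd[OF t] show ?thesis unfolding I_def by linarith
qed

text \<open>Banach's fixed point theorem applies in the supremum norm weighted by
  \<open>exp (- 2 \<integral> l)\<close>, in which the Picard operator is a contraction with factor \<open>1 / 2\<close>.\<close>

lemma caratheodory_existence:
  fixes f :: "real \<Rightarrow> 'a::euclidean_space \<Rightarrow> 'a"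
  assumes "a \<le> b" and l: "l absolutely_integrable_on {a..b}" "\<And>s. s \<in> {a..b} \<Longrightarrow> 0 \<le> l s"
    and int: "\<And>x. continuous_on {a..b} x \<Longrightarrow> (\<lambda>s. f s (x s)) integrable_on {a..b}"
    and lip: "\<And>s x y. s \<in> {a..b} \<Longrightarrow> norm (f s x - f s y) \<le> l s * norm (x - y)"
  shows "\<exists>x. continuous_on {a..b} x \<and> (\<forall>t\<in>{a..b}. x t = x0 + integral {a..t} (\<lambda>s. f s (x s)))"
proof -
  define I where "I t = integral {a..t} l" for t
  \<comment> \<open>Bounded continuous functions live on the whole line; clamping the time to
    \<open>{a..b}\<close> extends the Picard image by constants.\<close>
  define cl where "cl t = max a (min b t)" for t
  have cl: "cl t \<in> {a..b}" "t \<in> {a..b} \<Longrightarrow> cl t = t" for t using \<open>a \<le> b\<close> by (auto simp: cl_def)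
  have contcl: "continuous_on UNIV cl" unfolding cl_def by (intro continuous_intros)
  have li: "l integrable_on {a..b}" using l by (simp add: absolutely_integrable_on_def)
  have contI: "continuous_on {a..b} I"
    unfolding I_def by (rule indefinite_integral_continuous_1[OF li])
  \<comment> \<open>The unknown in the Banach space is \<open>z = exp (- 2 * I) x\<close>, so that
    its plain supremum norm is the weighted norm of \<open>x\<close>. \<open>X\<close> recovers
    \<open>x\<close>, and \<open>P\<close> is the Picard operator in the new variable.\<close>
  define X where "X z s = exp (2 * I s) *\<^sub>R apply_bcontfun z s" for z :: "real \<Rightarrow>\<^sub>C 'a" and s
  have contX: "continuous_on {a..b} (X z)" for z
    unfolding X_def by (intro continuous_intros contI continuous_on_apply_bcontfun)
  define P where "P z t = exp (- 2 * I t) *\<^sub>R (x0 + integral {a..t} (\<lambda>s. f s (X z s)))" for z t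
  have contP: "continuous_on {a..b} (P z)" for z
    unfolding P_def by (intro continuous_intros contI indefinite_integral_continuous_1 int contX)
  have bc: "(\<lambda>t. P z (cl t)) \<in> bcontfun" for z
  proof -
    have "bounded (P z ` {a..b})" by (intro compact_imp_bounded compact_continuous_image contP) auto
    then obtain B where B: "\<forall>y\<in>P z ` {a..b}. norm y \<le> B" unfolding bounded_iff by blast
    show ?thesis
    proof (rule bcontfun_normI)
      show "continuous_on UNIV (\<lambda>t. P z (cl t))"
        by (rule continuous_on_compose2[OF contP contcl]) (use cl in auto)
      show "norm (P z (cl t)) \<le> B" for t using cl B by blast
    qed
  qed
  define T where "T z = Bcontfun (\<lambda>t. P z (cl t))" for z
  have T: "apply_bcontfun (T z) t = P z (cl t)" for z t
    unfolding T_def using Bcontfun_inverse[OF bc] by simp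
  have "\<exists>!z. T z = z"
  proof (rule banach_fix_type[of "1/2"])
    show "\<forall>z w. dist (T z) (T w) \<le> 1 / 2 * dist z w"
    proof (intro allI dist_bound)
      fix z w :: "real \<Rightarrow>\<^sub>C 'a" and t0
      define t where "t = cl t0"
      have t: "t \<in> {a..b}" and sub: "{a..t} \<subseteq> {a..b}" using cl[of t0] by (auto simp: t_def)
      have w: "((\<lambda>s. 2 * l s * exp (2 * I s)) has_integral exp (2 * I t) - 1) {a..t}"
        unfolding I_def using t by (intro has_integral_exp_weight absolutely_integrable_on_subinterval[OF l(1) sub]) auto
      define d where "d = dist z w"
      have intX: "(\<lambda>s. f s (X z s)) integrable_on {a..t}" for z
        by (rule integrable_on_subinterval[OF int[OF contX] sub])
      have "norm (integral {a..t} (\<lambda>s. f s (X z s) - f s (X w s))) \<le>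
          integral {a..t} (\<lambda>s. d / 2 * (2 * l s * exp (2 * I s)))"
      proof (rule integral_norm_bound_integral)
        show "(\<lambda>s. f s (X z s) - f s (X w s)) integrable_on {a..t}" by (intro integrable_diff intX)
        show "(\<lambda>s. d / 2 * (2 * l s * exp (2 * I s))) integrable_on {a..t}"
          by (rule has_integral_integrable[OF has_integral_mult_right[OF w]])
        fix s assume "s \<in> {a..t}"
        then have s: "s \<in> {a..b}" using sub by blast
        have "norm (f s (X z s) - f s (X w s)) \<le> l s * norm (X z s - X w s)" by (rule lip[OF s])
        also have "X z s - X w s = exp (2 * I s) *\<^sub>R (apply_bcontfun z s - apply_bcontfun w s)"
          by (simp add: X_def algebra_simps)
        also have "norm \<dots> = exp (2 * I s) * dist (apply_bcontfun z s) (apply_bcontfun w s)"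
          by (simp add: dist_norm)
        also have "l s * (exp (2 * I s) * dist (apply_bcontfun z s) (apply_bcontfun w s)) \<le> l s * (exp (2 * I s) * d)"
          unfolding d_def using l(2)[OF s] by (intro mult_left_mono dist_bounded) auto
        finally show "norm (f s (X z s) - f s (X w s)) \<le> d / 2 * (2 * l s * exp (2 * I s))"
          by (simp add: mult_ac)
      qed
      also have "\<dots> = d / 2 * (exp (2 * I t) - 1)"
        using integral_unique[OF has_integral_mult_right[OF w, of "d / 2"]] .
      finally have le: "norm (integral {a..t} (\<lambda>s. f s (X z s) - f s (X w s))) \<le> d / 2 * (exp (2 * I t) - 1)" .
      have "P z t - P w t = exp (- 2 * I t) *\<^sub>R integral {a..t} (\<lambda>s. f s (X z s) - f s (X w s))"
        unfolding P_def using intX by (simp add: integral_diff scaleR_diff_right[symmetric])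
      then have "norm (P z t - P w t) = exp (- 2 * I t) * norm (integral {a..t} (\<lambda>s. f s (X z s) - f s (X w s)))"
        by simp
      also have "\<dots> \<le> exp (- 2 * I t) * (d / 2 * (exp (2 * I t) - 1))"
        using le by (intro mult_left_mono) auto
      also have "\<dots> = d / 2 * (1 - exp (- 2 * I t))" by (simp add: exp_minus field_simps)
      also have "\<dots> \<le> d / 2 * 1" by (intro mult_left_mono) (auto simp: d_def)
      finally show "dist (apply_bcontfun (T z) t0) (apply_bcontfun (T w) t0) \<le> 1 / 2 * dist z w"
        unfolding T t_def[symmetric] by (simp add: dist_norm d_def)
    qed
  qed auto
  then obtain z where z: "T z = z" by blast
  have "X z t = x0 + integral {a..t} (\<lambda>s. f s (X z s))" if "t \<in> {a..b}" for t
  proof -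
    have "apply_bcontfun z t = P z t" using T[of z t] cl(2)[OF that] z by simp
    then have "X z t = exp (2 * I t) *\<^sub>R P z t" by (simp add: X_def)
    then show ?thesis by (simp add: P_def exp_minus)
  qed
  with contX[of z] show ?thesis by blast
qed

section \<open>Integral form and almost-everywhere form of an equation\<close>

lemma integral_equation_imp_abs_cont:
  fixes g :: "real \<Rightarrow> 'a::euclidean_space"
  assumes g: "g absolutely_integrable_on {a..b}"
    and x: "\<And>t. t \<in> {a..b} \<Longrightarrow> x t = x0 + integral {a..t} g"
  shows "abs_cont_on_interval a b x"
    "AE t in lebesgue_on {a..b}. (x has_vector_derivative g t) (at t within {a..b})"
proof -
  show "abs_cont_on_interval a b x"
    by (rule abs_cont_dominated[OF abs_cont_indefinite_integral[OF g], where C = 1]) (simp add: x)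
  have gi: "g integrable_on {a..b}" using g by (simp add: absolutely_integrable_on_def)
  define N where "N = {t \<in> {a..b}. \<not> ((\<lambda>t. integral {a..t} g) has_vector_derivative g t) (at t within {a..b})}"
  have "N \<in> null_sets lebesgue"
    using lebesgue_differentiation[OF gi] by (simp add: N_def negligible_iff_null_sets)
  then have "AE t in lebesgue. t \<notin> N" by (rule AE_not_in)
  moreover have "(x has_vector_derivative g t) (at t within {a..b})" if "t \<notin> N" "t \<in> {a..b}" for t
  proof -
    have "((\<lambda>t. x0 + integral {a..t} g) has_vector_derivative 0 + g t) (at t within {a..b})"
      using that by (intro has_vector_derivative_add) (auto simp: N_def)
    then have "((\<lambda>t. x0 + integral {a..t} g) has_vector_derivative g t) (at t within {a..b})" by simp
    then show ?thesis
      by (rule has_vector_derivative_transform[rotated 2]) (use x \<open>t \<in> {a..b}\<close> in auto)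
  qed
  ultimately have "AE t in lebesgue. t \<in> {a..b} \<longrightarrow> (x has_vector_derivative g t) (at t within {a..b})"
    by (auto elim: eventually_mono)
  then show "AE t in lebesgue_on {a..b}. (x has_vector_derivative g t) (at t within {a..b})"
    by (simp add: AE_restrict_space_iff)
qed

text \<open>This turns almost-everywhere equations into integral identities, for solutions in
  \<open>solves_iff_integral\<close> and for the product of costate and state difference in
  \<open>costate_variation\<close>.\<close>

lemma abs_cont_AE_has_integral:
  fixes f :: "real \<Rightarrow> 'a::euclidean_space"
  assumes ac: "abs_cont_on_interval a b f" and t: "t \<in> {a..b}"
    and deriv: "AE t in lebesgue_on {a..b}. (f has_vector_derivative g t) (at t within {a..b})"
  shows "(g has_integral f t - f a) {a..t}"
proof -
  obtain N where N: "N \<in> null_sets lebesgue" "{t. \<not> (t \<in> {a..b} \<longrightarrow> (f has_vector_derivative g t) (at t within {a..b}))} \<subseteq> N"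
    using deriv unfolding AE_restrict_space_iff[of "{a..b}" lebesgue, simplified]
    by (auto elim!: AE_E3 simp: eventually_ae_filter)
  have "abs_cont_on_interval a t f"
  proof (rule abs_cont_on_intervalI)
    fix \<epsilon> :: real assume "\<epsilon> > 0"
    have "nonoverlapping a b P" if "nonoverlapping a t P" for P
      using that t unfolding nonoverlapping_def by fastforce
    then show "\<exists>\<delta>>0. \<forall>P. nonoverlapping a t P \<longrightarrow> (\<Sum>(s, t)\<in>P. t - s) < \<delta> \<longrightarrow> (\<Sum>(s, t)\<in>P. norm (f t - f s)) < \<epsilon>"
      using abs_cont_on_intervalD[OF ac \<open>\<epsilon> > 0\<close>] by meson
  qed
  then show ?thesis
  proof (rule abs_cont_has_integral)
    show "negligible N" using N by (simp add: negligible_iff_null_sets)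
    fix s assume "s \<in> {a..t} - N"
    then have "(f has_vector_derivative g s) (at s within {a..b})" using N(2) t by auto
    then show "(f has_vector_derivative g s) (at s within {a..t})"
      by (rule has_vector_derivative_within_subset) (use t in auto)
  qed (use t in auto)
qed

section \<open>Control systems and their adjoint equation\<close>

lemma bilinear_matrix_vector_mult: "bilinear ((*v) :: real^'k^'n \<Rightarrow> real^'k \<Rightarrow> real^'n)"
  by (auto simp: bilinear_def linear_iff matrix_vector_mult_def vec_eq_iff sum.distrib
      sum_distrib_left algebra_simps)

lemma bilinear_vector_matrix_mult: "bilinear ((v*) :: real^'n \<Rightarrow> real^'k^'n \<Rightarrow> real^'k)"
  by (auto simp: bilinear_def linear_iff vector_matrix_mult_def vec_eq_iff sum.distrib
      sum_distrib_left algebra_simps)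

lemma absolutely_integrable_continuous_bilinear:
  fixes h :: "'b::euclidean_space \<Rightarrow> 'c::euclidean_space \<Rightarrow> 'd::euclidean_space" and x :: "real \<Rightarrow> 'b"
  assumes "bilinear h" "continuous_on {a..b} x" "g absolutely_integrable_on {a..b}"
  shows "(\<lambda>s. h (x s) (g s)) absolutely_integrable_on {a..b}"
proof (rule absolutely_integrable_bounded_measurable_product[OF assms(1) _ _ _ assms(3)])
  show "x \<in> borel_measurable (lebesgue_on {a..b})"
    using assms(2) by (intro continuous_imp_measurable_on_sets_lebesgue) auto
  show "bounded (x ` {a..b})"
    using assms(2) by (intro compact_imp_bounded compact_continuous_image) auto
qed auto

text \<open>The terminal value problem becomes an initial value problem for \<open>t \<mapsto> l (- t)\<close> on \<open>{-b..-a}\<close>.\<close>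

lemma adjoint_equation_existence:
  fixes A :: "real \<Rightarrow> real^'n^'n"
  assumes "a \<le> b" and A: "A absolutely_integrable_on {a..b}"
  shows "\<exists>l. continuous_on {a..b} l \<and> l b = p \<and>
    (\<forall>t\<in>{a..b}. l t = l a + integral {a..t} (\<lambda>s. - (l s v* A s)))"
proof -
  obtain C where C: "C > 0" "\<And>(y :: real^'n) (B :: real^'n^'n). norm (y v* B) \<le> C * norm y * norm B"
    using bilinear_bounded_pos[OF bilinear_vector_matrix_mult] by blast
  have Ar: "(\<lambda>s. A (- s)) absolutely_integrable_on {-b..-a}"
    using A by simp
  have "\<exists>m. continuous_on {-b..-a} m \<and> (\<forall>t\<in>{-b..-a}. m t = p + integral {-b..t} (\<lambda>s. m s v* A (- s)))"
  proof (rule caratheodory_existence[where l = "\<lambda>s. C * norm (A (- s))"])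
    show "(\<lambda>s. C * norm (A (- s))) absolutely_integrable_on {-b..-a}"
      by (rule set_integrable_mult_right, rule absolutely_integrable_norm[OF Ar, unfolded o_def])
    show "(\<lambda>s. x s v* A (- s)) integrable_on {-b..-a}" if "continuous_on {-b..-a} x" for x :: "real \<Rightarrow> real^'n"
      using absolutely_integrable_continuous_bilinear[OF bilinear_vector_matrix_mult that Ar]
      by (simp add: absolutely_integrable_on_def)
    show "norm (x v* A (- s) - y v* A (- s)) \<le> C * norm (A (- s)) * norm (x - y)" for s and x y :: "real^'n"
      using C(2)[of "x - y" "A (- s)"] bilinear_lsub[OF bilinear_vector_matrix_mult, of x y "A (- s)"]
      by (simp add: mult_ac)
  qed (use C(1) \<open>a \<le> b\<close> in auto)
  then obtain m where m: "continuous_on {-b..-a} m"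
    "\<And>t. t \<in> {-b..-a} \<Longrightarrow> m t = p + integral {-b..t} (\<lambda>s. m s v* A (- s))" by blast
  define l where "l t = m (- t)" for t
  define g where "g s = l s v* A s" for s
  have contl: "continuous_on {a..b} l" unfolding l_def
    by (rule continuous_on_compose2[OF m(1)]) (auto intro: continuous_intros)
  have gi: "g integrable_on {a..b}"
    unfolding g_def using absolutely_integrable_continuous_bilinear[OF bilinear_vector_matrix_mult contl A]
    by (simp add: absolutely_integrable_on_def)
  have l: "l t = p + integral {t..b} g" if "t \<in> {a..b}" for t
  proof -
    have "l t = p + integral {-b..-t} (\<lambda>s. g (- s))"
      unfolding l_def[of t] using m(2)[of "- t"] that by (simp add: g_def l_def)
    then show ?thesis by simp
  qed
  show ?thesis
  proof (intro exI[of _ l] conjI ballI)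
    show "l b = p" using l[of b] \<open>a \<le> b\<close> by simp
    fix t assume t: "t \<in> {a..b}"
    \<comment> \<open>Splitting at \<open>t\<close> changes the equation from terminal to initial
      form, the one that \<open>integral_equation_imp_abs_cont\<close> accepts.\<close>
    have "integral {a..t} g + integral {t..b} g = integral {a..b} g"
      using t gi by (intro Henstock_Kurzweil_Integration.integral_combine) auto
    then have "l a = l t + integral {a..t} g"
      using l[OF t] l[of a] t by (simp add: algebra_simps)
    then show "l t = l a + integral {a..t} (\<lambda>s. - (l s v* A s))"
      by (simp add: g_def[symmetric] integral_neg)
  qed (rule contl)
qed

text \<open>The increments \<open>y n - x\<close> need not be multiples of a fixed direction: being
  of order \<open>e n\<close>, they make the remainder of the first-order expansion small compared
  with \<open>e n\<close>.\<close>

lemma has_derivative_quotient_limit: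
  fixes g :: "'a::real_normed_vector \<Rightarrow> 'b::real_normed_vector" and e :: "nat \<Rightarrow> real"
  assumes g: "(g has_derivative g') (at x)" and e: "\<And>n. e n > 0" "e \<longlonglongrightarrow> 0"
    and d: "\<And>n. norm (y n - x) \<le> C * e n"
  shows "(\<lambda>n. (g (y n) - g x - g' (y n - x)) /\<^sub>R e n) \<longlonglongrightarrow> 0"
proof -
  have C: "C \<ge> 0" using order_trans[OF norm_ge_zero d[of 0]] e(1)[of 0] by (simp add: zero_le_mult_iff)
  have "(\<lambda>n. C * e n) \<longlonglongrightarrow> 0" using tendsto_mult_left[OF e(2), of C] by simp
  then have lim: "(\<lambda>n. y n - x) \<longlonglongrightarrow> 0"
    by (rule Lim_null_comparison[rotated]) (simp add: d)
  show ?thesis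
    unfolding tendsto_iff
  proof (intro allI impI)
    fix \<epsilon> :: real assume "\<epsilon> > 0"
    define \<eta> where "\<eta> = \<epsilon> / (2 * (C + 1))"
    have \<eta>: "\<eta> > 0" "\<eta> * C < \<epsilon>" using C \<open>\<epsilon> > 0\<close> mult_nonneg_nonneg[of C \<epsilon>] by (auto simp: \<eta>_def field_simps add_nonneg_pos)
    obtain \<delta> where \<delta>: "\<delta> > 0" "\<forall>z. norm (z - x) < \<delta> \<longrightarrow> norm (g z - g x - g' (z - x)) \<le> \<eta> * norm (z - x)"
      using g \<eta>(1) unfolding has_derivative_at_alt by blast
    have "\<forall>\<^sub>F n in sequentially. norm (y n - x) < \<delta>"
      using tendstoD[OF lim \<delta>(1)] by (simp add: dist_norm)
    then show "\<forall>\<^sub>F n in sequentially. dist ((g (y n) - g x - g' (y n - x)) /\<^sub>R e n) 0 < \<epsilon>"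
    proof eventually_elim
      case (elim n)
      have "norm (g (y n) - g x - g' (y n - x)) \<le> \<eta> * norm (y n - x)" using \<delta>(2) elim by blast
      also have "\<dots> \<le> \<eta> * (C * e n)" using d[of n] \<eta> by (intro mult_left_mono) auto
      also have "\<dots> < \<epsilon> * e n" using mult_strict_right_mono[OF \<eta>(2) e(1)[of n]] by (simp add: mult_ac)
      finally have "norm (g (y n) - g x - g' (y n - x)) / e n < \<epsilon>" using e(1)[of n] by (simp add: pos_divide_less_eq)
      then show ?case using e(1)[of n] by (simp add: divide_inverse mult.commute)
    qed
  qed
qed

section \<open>The controlled equation for a single parameter\<close>

lemma C1_regular_imp_continuous_on:
  assumes "C1_regular f"
  shows "continuous_on S f"
proof -
  obtain f' where "\<forall>x. (f has_derivative blinfun_apply (f' x)) (at x)"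
    using assms unfolding C1_regular_def by blast
  then have "\<forall>x. isCont f x" using has_derivative_continuous by blast
  then show ?thesis by (simp add: continuous_at_imp_continuous_on)
qed

text \<open>\<open>lip_control\<close> measures a matrix difference by its action on
  \<open>w\<close>, the way in which controls enter the dynamics. \<open>K\<close> leaves room for
  the factor lost when such a bound is derived from the columns.\<close>

locale control_system =
  fixes F0 :: "real^'n \<Rightarrow> 'p \<Rightarrow> real^'n" and F :: "real^'n \<Rightarrow> 'p \<Rightarrow> real^'k^'n"
    and x0 :: "'p \<Rightarrow> real^'n" and \<theta> :: 'p and K :: real
  assumes K: "K > 0"
    and lip_drift: "norm (F0 x \<theta> - F0 y \<theta>) \<le> K * norm (x - y)"
    and lip_control: "norm ((F x \<theta> - F y \<theta>) *v w) \<le> K * norm (x - y) * norm w"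
    and C1_drift: "C1_regular (\<lambda>x. F0 x \<theta>)"
    and C1_control: "C1_regular (\<lambda>x. F x \<theta>)"
begin

abbreviation rhs :: "(real \<Rightarrow> real^'k) \<Rightarrow> (real \<Rightarrow> real^'n) \<Rightarrow> real \<Rightarrow> real^'n" where
  "rhs u x s \<equiv> F0 (x s) \<theta> + F (x s) \<theta> *v u s"

abbreviation traj :: "(real \<Rightarrow> real^'k) \<Rightarrow> real \<Rightarrow> real^'n" where
  "traj u \<equiv> trajectory F0 F x0 u \<theta>"

lemma continuous_drift: "continuous_on S (\<lambda>x. F0 x \<theta>)"
  and continuous_control: "continuous_on S (\<lambda>x. F x \<theta>)"
  using C1_regular_imp_continuous_on[OF C1_drift] C1_regular_imp_continuous_on[OF C1_control] by blast+

lemma rhs_integrable: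
  assumes "u absolutely_integrable_on {0..1}" "continuous_on {0..1} x"
  shows "rhs u x absolutely_integrable_on {0..1}"
proof (rule set_integral_add(1))
  show "(\<lambda>s. F0 (x s) \<theta>) absolutely_integrable_on {0..1}"
    by (intro absolutely_integrable_continuous_real continuous_on_compose2[OF continuous_drift assms(2)]) auto
  show "(\<lambda>s. F (x s) \<theta> *v u s) absolutely_integrable_on {0..1}"
    by (intro absolutely_integrable_continuous_bilinear[OF bilinear_matrix_vector_mult _ assms(1)]
        continuous_on_compose2[OF continuous_control assms(2)]) auto
qed

text \<open>The Lipschitz weight grows with \<open>norm (u s)\<close> and is only integrable in
  time; for this reason \<open>gronwall\<close> and \<open>caratheodory_existence\<close> are stated
  for integrable weights.\<close>

lemma rhs_lipschitz:
  "norm (rhs u x s - rhs u y s) \<le> K * (1 + norm (u s)) * norm (x s - y s)"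
proof -
  have "rhs u x s - rhs u y s = (F0 (x s) \<theta> - F0 (y s) \<theta>) + (F (x s) \<theta> - F (y s) \<theta>) *v u s"
    by (simp add: matrix_vector_mult_diff_rdistrib)
  also have "norm \<dots> \<le> K * norm (x s - y s) + K * norm (x s - y s) * norm (u s)"
    by (intro norm_triangle_mono lip_drift lip_control)
  finally show ?thesis by (simp add: algebra_simps)
qed

lemma weight_integrable:
  fixes u :: "real \<Rightarrow> real^'k"
  assumes "u absolutely_integrable_on {0..1}"
  shows "(\<lambda>s. K * (1 + norm (u s))) absolutely_integrable_on {0..1}"
proof (rule set_integrable_mult_right, rule set_integral_add(1))
  show "(\<lambda>s :: real. 1 :: real) absolutely_integrable_on {0..1}" by (rule absolutely_integrable_continuous_real) simp
  show "(\<lambda>s. norm (u s)) absolutely_integrable_on {0..1}"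
    by (rule absolutely_integrable_norm[OF assms, unfolded o_def])
qed

lemma solves_iff_integral:
  assumes u: "u absolutely_integrable_on {0..1}"
  shows "solves_control_system F0 F x0 u \<theta> x \<longleftrightarrow>
    continuous_on {0..1} x \<and> (\<forall>t\<in>{0..1}. x t = x0 \<theta> + integral {0..t} (rhs u x))"
proof
  assume s: "solves_control_system F0 F x0 u \<theta> x"
  then have ac: "abs_cont_on_interval 0 1 x" and x0: "x 0 = x0 \<theta>"
    and d: "AE t in lebesgue_on {0..1}. (x has_vector_derivative rhs u x t) (at t within {0..1})"
    by (auto simp: solves_control_system_def)
  have "x t = x0 \<theta> + integral {0..t} (rhs u x)" if "t \<in> {0..1}" for t
    using integral_unique[OF abs_cont_AE_has_integral[OF ac that d]] x0 by simp
  with abs_cont_imp_continuous_on[OF ac]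
  show "continuous_on {0..1} x \<and> (\<forall>t\<in>{0..1}. x t = x0 \<theta> + integral {0..t} (rhs u x))" by blast
next
  assume x: "continuous_on {0..1} x \<and> (\<forall>t\<in>{0..1}. x t = x0 \<theta> + integral {0..t} (rhs u x))"
  then have cont: "continuous_on {0..1} x" by blast
  from x have eq: "x t = x0 \<theta> + integral {0..t} (rhs u x)" if "t \<in> {0..1}" for t
    using that by blast
  have "x 0 = x0 \<theta>" using eq[of 0] by simp
  with integral_equation_imp_abs_cont[where x = x, OF rhs_integrable[OF u cont] eq]
  show "solves_control_system F0 F x0 u \<theta> x" unfolding solves_control_system_def by simp
qed

lemma solution_unique:
  assumes u: "u absolutely_integrable_on {0..1}"
    and x: "solves_control_system F0 F x0 u \<theta> x" and y: "solves_control_system F0 F x0 u \<theta> y"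
    and t: "t \<in> {0..1}"
  shows "x t = y t"
proof -
  have cont: "continuous_on {0..1} x" "continuous_on {0..1} y"
    and eq: "\<And>t. t \<in> {0..1} \<Longrightarrow> x t = x0 \<theta> + integral {0..t} (rhs u x)"
      "\<And>t. t \<in> {0..1} \<Longrightarrow> y t = x0 \<theta> + integral {0..t} (rhs u y)"
    using x y by (auto simp: solves_iff_integral[OF u])
  \<comment> \<open>Gronwall's inequality with \<open>c = 0\<close>, because both solutions start at
    the same point.\<close>
  have "norm (x t - y t) \<le> 2 * 0 * exp (2 * integral {0..t} (\<lambda>s. K * (1 + norm (u s))))"
  proof (rule gronwall[OF weight_integrable[OF u] _ _ _ _ t])
    fix t :: real assume t: "t \<in> {0..1}"
    then have sub: "{0..t} \<subseteq> {0..1}" by auto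
    have int: "rhs u x integrable_on {0..t}" "rhs u y integrable_on {0..t}"
      using absolutely_integrable_on_subinterval[OF rhs_integrable[OF u cont(1)] sub]
        absolutely_integrable_on_subinterval[OF rhs_integrable[OF u cont(2)] sub]
      by (simp_all add: absolutely_integrable_on_def)
    have "(\<lambda>s. (K * (1 + norm (u s))) *\<^sub>R norm (x s - y s)) absolutely_integrable_on {0..1}"
      by (intro continuous_times_absolutely_integrable weight_integrable u continuous_intros cont)
    then have int': "(\<lambda>s. K * (1 + norm (u s)) * norm (x s - y s)) integrable_on {0..t}"
      using absolutely_integrable_on_subinterval[OF _ sub] by (fastforce simp: absolutely_integrable_on_def)
    have "x t - y t = integral {0..t} (\<lambda>s. rhs u x s - rhs u y s)"
      using eq[OF t] int by (simp add: integral_diff)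
    also have "norm \<dots> \<le> integral {0..t} (\<lambda>s. K * (1 + norm (u s)) * norm (x s - y s))"
      by (intro integral_norm_bound_integral integrable_diff int int' rhs_lipschitz)
    finally show "norm (x t - y t) \<le> 0 + integral {0..t} (\<lambda>s. K * (1 + norm (u s)) * norm (x s - y s))" by simp
  qed (use K in \<open>auto intro!: continuous_intros cont\<close>)
  then show ?thesis by simp
qed

lemma solution_exists:
  assumes u: "u absolutely_integrable_on {0..1}"
  shows "\<exists>x. solves_control_system F0 F x0 u \<theta> x"
proof -
  have "\<exists>x. continuous_on {0..1} x \<and> (\<forall>t\<in>{0..1}. x t = x0 \<theta> + integral {0..t} (\<lambda>s. F0 (x s) \<theta> + F (x s) \<theta> *v u s))"
  proof (rule caratheodory_existence[where f = "\<lambda>s y. F0 y \<theta> + F y \<theta> *v u s", OF _ weight_integrable[OF u]])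
    show "(\<lambda>s. F0 (x s) \<theta> + F (x s) \<theta> *v u s) integrable_on {0..1}" if "continuous_on {0..1} x" for x
      using rhs_integrable[OF u that] by (simp add: absolutely_integrable_on_def)
    show "norm ((F0 x \<theta> + F x \<theta> *v u s) - (F0 y \<theta> + F y \<theta> *v u s)) \<le> K * (1 + norm (u s)) * norm (x - y)" for s x y
      using rhs_lipschitz[where u = u and s = s and x = "\<lambda>_. x" and y = "\<lambda>_. y"] .
  qed (use K in auto)
  then show ?thesis using solves_iff_integral[OF u] by blast
qed

text \<open>Restricting a solution to the interval makes it extensional; uniqueness on
  \<open>{0..1}\<close> then becomes equality of functions, as the definite description
  requires.\<close>

lemma trajectory_solves:
  assumes u: "u absolutely_integrable_on {0..1}"
  shows "solves_control_system F0 F x0 u \<theta> (traj u)"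
proof -
  obtain y where y: "solves_control_system F0 F x0 u \<theta> y" using solution_exists[OF u] by blast
  define x where "x = restrict y {0..1}"
  have xy: "x t = y t" if "t \<in> {0..1}" for t using that by (simp add: x_def)
  have "integral {0..t} (rhs u x) = integral {0..t} (rhs u y)" if "t \<in> {0..1}" for t
    using that by (intro integral_cong) (auto simp: xy)
  moreover have "continuous_on {0..1} x \<longleftrightarrow> continuous_on {0..1} y"
    using xy by (intro continuous_on_cong) auto
  ultimately have x: "solves_control_system F0 F x0 u \<theta> x"
    using y xy unfolding solves_iff_integral[OF u] by simp
  let ?P = "\<lambda>z. z \<in> extensional {0..1} \<and> solves_control_system F0 F x0 u \<theta> z"
  have "?P (THE z. ?P z)"
  proof (rule theI[of ?P x])
    show "?P x" using x by (simp add: x_def)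
    fix z assume "?P z"
    then show "z = x"
      using solution_unique[OF u _ x, of z] by (intro extensionalityI[of z "{0..1}" x]) (auto simp: x_def)
  qed
  then show ?thesis unfolding trajectory_def by blast
qed

lemma continuous_trajectory:
  assumes "u absolutely_integrable_on {0..1}"
  shows "continuous_on {0..1} (traj u)"
  and "t \<in> {0..1} \<Longrightarrow> traj u t = x0 \<theta> + integral {0..t} (rhs u (traj u))"
  using trajectory_solves[OF assms] unfolding solves_iff_integral[OF assms] by blast+

end

section \<open>Jacobians of continuously differentiable fields\<close>

lemma C1_regular_bounded_linear:
  assumes g: "C1_regular g" and h: "bounded_linear h"
  shows "C1_regular (\<lambda>x. h (g x))"
proof -
  obtain g' where g': "\<And>x. (g has_derivative blinfun_apply (g' x)) (at x)" "continuous_on UNIV g'"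
    using g unfolding C1_regular_def by blast
  define H where "H = Blinfun h"
  have H: "blinfun_apply H = h" unfolding H_def by (rule bounded_linear_Blinfun_apply[OF h])
  show ?thesis
    unfolding C1_regular_def
  proof (intro exI[of _ "\<lambda>x. H o\<^sub>L g' x"] conjI allI)
    show "((\<lambda>x. h (g x)) has_derivative blinfun_apply (H o\<^sub>L g' x)) (at x)" for x
    proof -
      have "blinfun_apply (H o\<^sub>L g' x) = (\<lambda>y. h (blinfun_apply (g' x) y))" by (rule ext) (simp add: H)
      then show ?thesis using bounded_linear.has_derivative[OF h g'(1)[of x]] by simp
    qed
    show "continuous_on UNIV (\<lambda>x. H o\<^sub>L g' x)"
      by (intro bounded_bilinear.continuous_on[OF bounded_bilinear_blinfun_compose] continuous_on_const g'(2))
  qed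
qed

lemma C1_regular_differentiable:
  assumes "C1_regular g"
  shows "g differentiable at x"
  using assms unfolding C1_regular_def differentiable_def by blast

lemma continuous_jacobian:
  fixes g :: "real^'n \<Rightarrow> real^'m"
  assumes "C1_regular g"
  shows "continuous_on S (\<lambda>x. jacobian g (at x))"
proof -
  obtain g' where g': "\<And>x. (g has_derivative blinfun_apply (g' x)) (at x)" "continuous_on UNIV g'"
    using assms unfolding C1_regular_def by blast
  have "jacobian g (at x) = (\<chi> i j. blinfun_apply (g' x) (axis j 1) $ i)" for x
    unfolding jacobian_def frechet_derivative_at[OF g'(1)[of x], symmetric] matrix_def ..
  moreover have "continuous_on S (\<lambda>x. \<chi> i j. blinfun_apply (g' x) (axis j 1) $ i)"
    by (intro continuous_intros continuous_on_subset[OF g'(2)]) auto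
  ultimately show ?thesis by simp
qed

lemma bounded_linear_column: "bounded_linear (column i :: real^'k^'n \<Rightarrow> real^'n)"
  by (rule linear_conv_bounded_linear[THEN iffD1]) (auto simp: linear_iff column_def vec_eq_iff)

context control_system
begin

abbreviation jac :: "real^'n \<Rightarrow> real^'k \<Rightarrow> real^'n^'n" where
  "jac z w \<equiv> jacobian (\<lambda>x. F0 x \<theta>) (at z) + (\<Sum>i\<in>UNIV. (w $ i) *\<^sub>R jacobian (\<lambda>x. column i (F x \<theta>)) (at z))"

lemma C1_column: "C1_regular (\<lambda>x. column i (F x \<theta>))"
  by (rule C1_regular_bounded_linear[OF C1_control bounded_linear_column])

text \<open>Expanding \<open>F x \<theta> *v w\<close> in the columns of \<open>F\<close> produces
  the combination of column Jacobians that the adjoint equation contains.\<close>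

lemma has_derivative_rhs:
  "((\<lambda>x. F0 x \<theta> + F x \<theta> *v w) has_derivative (\<lambda>h. jac z w *v h)) (at z)"
proof -
  have eq: "F x \<theta> *v w = (\<Sum>i\<in>UNIV. (w $ i) *\<^sub>R column i (F x \<theta>))" for x
    by (simp add: matrix_mult_sum scalar_mult_eq_scaleR)
  have eq': "jac z w *v h = jacobian (\<lambda>x. F0 x \<theta>) (at z) *v h +
      (\<Sum>i\<in>UNIV. (w $ i) *\<^sub>R (jacobian (\<lambda>x. column i (F x \<theta>)) (at z) *v h))" for h
  proof -
    have "linear (\<lambda>A :: real^'n^'n. A *v h)" using bilinear_matrix_vector_mult[where 'k = 'n and 'n = 'n] by (simp add: bilinear_def)
    then show ?thesis
      by (simp add: linear_sum[of "\<lambda>A. A *v h"] matrix_vector_mult_add_rdistrib bilinear_lmul[OF bilinear_matrix_vector_mult])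
  qed
  show ?thesis
    unfolding eq eq'
    using C1_regular_differentiable[OF C1_drift, of z] C1_regular_differentiable[OF C1_column, where x = z]
    unfolding jacobian_works
    by (intro has_derivative_add has_derivative_sum has_derivative_scaleR_right) auto
qed

lemma jac_integrable:
  fixes u :: "real \<Rightarrow> real^'k" and x :: "real \<Rightarrow> real^'n"
  assumes "u absolutely_integrable_on {0..1}" "continuous_on {0..1} x"
  shows "(\<lambda>s. jac (x s) (u s)) absolutely_integrable_on {0..1}"
proof (intro set_integral_add(1) absolutely_integrable_sum)
  show "(\<lambda>s. jacobian (\<lambda>x. F0 x \<theta>) (at (x s))) absolutely_integrable_on {0..1}"
    by (intro absolutely_integrable_continuous_real continuous_on_compose2[OF continuous_jacobian[OF C1_drift] assms(2)]) auto
  show "(\<lambda>s. (u s $ i) *\<^sub>R jacobian (\<lambda>x. column i (F x \<theta>)) (at (x s))) absolutely_integrable_on {0..1}" for i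
  proof (rule continuous_times_absolutely_integrable)
    show "(\<lambda>s. u s $ i) absolutely_integrable_on {0..1}"
      using absolutely_integrable_component[OF assms(1), of "axis i 1"] by (simp add: cart_eq_inner_axis)
    show "continuous_on {0..1} (\<lambda>s. jacobian (\<lambda>x. column i (F x \<theta>)) (at (x s)))"
      by (intro continuous_on_compose2[OF continuous_jacobian[OF C1_column] assms(2)]) auto
  qed
qed auto

section \<open>Trajectories under a perturbed control\<close>

lemma control_perturbation_integrable:
  fixes u v :: "real \<Rightarrow> real^'k"
  assumes "u absolutely_integrable_on {0..1}" "v absolutely_integrable_on {0..1}"
  shows "(\<lambda>s. u s + e *\<^sub>R v s) absolutely_integrable_on {0..1}"
  using assms by (intro set_integral_add(1)) auto

text \<open>The three terms are the effect of the changed state under \<open>u\<close>, a mixed term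
  that is of second order in \<open>e\<close> once \<open>y - x\<close> is of order
  \<open>e\<close>, and the direct effect of \<open>v\<close> along \<open>x\<close>.\<close>

lemma rhs_perturbation:
  "rhs (\<lambda>s. u s + e *\<^sub>R v s) y s - rhs u x s =
    (rhs u y s - rhs u x s) + e *\<^sub>R ((F (y s) \<theta> - F (x s) \<theta>) *v v s) + e *\<^sub>R (F (x s) \<theta> *v v s)"
  by (simp add: matrix_vector_right_distrib bilinear_rmul[OF bilinear_matrix_vector_mult]
      matrix_vector_mult_diff_rdistrib algebra_simps)

text \<open>Since \<open>e\<close> is at most 1 in absolute value, the mixed term is absorbed
  through \<open>norm (v s)\<close> into a weight that serves all such \<open>e\<close>.\<close>

lemma rhs_perturbation_bound:
  assumes "\<bar>e\<bar> \<le> 1"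
  shows "norm (rhs (\<lambda>s. u s + e *\<^sub>R v s) y s - rhs u x s) \<le>
    K * (1 + (norm (u s) + norm (v s))) * norm (y s - x s) + \<bar>e\<bar> * norm (F (x s) \<theta> *v v s)"
proof -
  have "norm (e *\<^sub>R ((F (y s) \<theta> - F (x s) \<theta>) *v v s)) \<le> 1 * (K * norm (y s - x s) * norm (v s))"
    using assms unfolding norm_scaleR by (intro mult_mono lip_control) auto
  then have "norm (rhs (\<lambda>s. u s + e *\<^sub>R v s) y s - rhs u x s) \<le>
      K * (1 + norm (u s)) * norm (y s - x s) + 1 * (K * norm (y s - x s) * norm (v s)) + \<bar>e\<bar> * norm (F (x s) \<theta> *v v s)"
    unfolding rhs_perturbation by (intro norm_triangle_mono rhs_lipschitz) auto
  then show ?thesis by (simp add: algebra_simps)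
qed

text \<open>Gronwall's inequality for the norm of the difference, started from
  \<open>\<bar>e\<bar> * c\<close>; neither \<open>c\<close> nor the weight depends on
  \<open>e\<close>, so the estimate is uniform in both \<open>e\<close> and
  \<open>t\<close>.\<close>

lemma trajectory_perturbation:
  assumes u: "u absolutely_integrable_on {0..1}" and v: "v absolutely_integrable_on {0..1}"
  obtains C where "\<forall>e t. \<bar>e\<bar> \<le> 1 \<longrightarrow> t \<in> {0..1} \<longrightarrow>
    norm (traj (\<lambda>s. u s + e *\<^sub>R v s) t - traj u t) \<le> C * \<bar>e\<bar>"
proof -
  define x where "x = traj u"
  define l where "l s = K * (1 + (norm (u s) + norm (v s)))" for s
  define c where "c = integral {0..1} (\<lambda>s. norm (F (x s) \<theta> *v v s))"
  note cx = continuous_trajectory[OF u, folded x_def]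
  have l0: "l s \<ge> 0" for s using K by (simp add: l_def)
  have l: "l absolutely_integrable_on {0..1}"
    unfolding l_def
  proof (rule set_integrable_mult_right, rule set_integral_add(1))
    show "(\<lambda>s :: real. 1 :: real) absolutely_integrable_on {0..1}" by (rule absolutely_integrable_continuous_real) simp
    show "(\<lambda>s. norm (u s) + norm (v s)) absolutely_integrable_on {0..1}"
      using absolutely_integrable_norm[OF u, unfolded o_def] absolutely_integrable_norm[OF v, unfolded o_def]
      by (rule set_integral_add(1))
  qed
  have Fv: "(\<lambda>s. norm (F (x s) \<theta> *v v s)) absolutely_integrable_on {0..1}"
    by (intro absolutely_integrable_norm[unfolded o_def]
        absolutely_integrable_continuous_bilinear[OF bilinear_matrix_vector_mult _ v]
        continuous_on_compose2[OF continuous_control cx(1)]) auto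
  have "norm (traj (\<lambda>s. u s + e *\<^sub>R v s) t - traj u t) \<le> 2 * c * exp (2 * integral {0..1} l) * \<bar>e\<bar>"
    if e: "\<bar>e\<bar> \<le> 1" and t: "t \<in> {0..1}" for e t
  proof -
    define w where "w s = u s + e *\<^sub>R v s" for s
    have w: "w absolutely_integrable_on {0..1}"
      unfolding w_def by (rule control_perturbation_integrable[OF u v])
    define y where "y = traj w"
    note cy = continuous_trajectory[OF w, folded y_def]
    have "norm (y t - x t) \<le> 2 * (\<bar>e\<bar> * c) * exp (2 * integral {0..t} l)"
    proof (rule gronwall[OF l l0 _ _ _ t])
      show "continuous_on {0..1} (\<lambda>t. norm (y t - x t))" by (intro continuous_intros cx cy)
      fix t :: real assume t: "t \<in> {0..1}"
      then have sub: "{0..t} \<subseteq> {0..1}" by auto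
      have int: "rhs w y integrable_on {0..t}" "rhs u x integrable_on {0..t}"
        using absolutely_integrable_on_subinterval[OF rhs_integrable[OF w cy(1)] sub]
          absolutely_integrable_on_subinterval[OF rhs_integrable[OF u cx(1)] sub]
        by (simp_all add: absolutely_integrable_on_def)
      have "(\<lambda>s. l s *\<^sub>R norm (y s - x s)) absolutely_integrable_on {0..1}"
        by (intro continuous_times_absolutely_integrable l continuous_intros cx cy)
      from absolutely_integrable_on_subinterval[OF this sub]
      have int1: "(\<lambda>s. l s * norm (y s - x s)) integrable_on {0..t}" by (simp add: absolutely_integrable_on_def)
      have int2: "(\<lambda>s. norm (F (x s) \<theta> *v v s)) integrable_on {0..t}" "(\<lambda>s. norm (F (x s) \<theta> *v v s)) integrable_on {0..1}"
        using absolutely_integrable_on_subinterval[OF Fv sub] Fv by (simp_all add: absolutely_integrable_on_def)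
      have "y t - x t = integral {0..t} (\<lambda>s. rhs w y s - rhs u x s)"
        using cx(2)[OF t] cy(2)[OF t] int by (simp add: integral_diff)
      also have "norm \<dots> \<le> integral {0..t} (\<lambda>s. l s * norm (y s - x s) + \<bar>e\<bar> * norm (F (x s) \<theta> *v v s))"
      proof (rule integral_norm_bound_integral)
        show "norm (rhs w y s - rhs u x s) \<le> l s * norm (y s - x s) + \<bar>e\<bar> * norm (F (x s) \<theta> *v v s)" for s
          unfolding w_def l_def by (rule rhs_perturbation_bound[OF e])
        show "(\<lambda>s. l s * norm (y s - x s) + \<bar>e\<bar> * norm (F (x s) \<theta> *v v s)) integrable_on {0..t}"
          by (intro integrable_add int1 integrable_on_mult_right int2)
      qed (intro integrable_diff int)
      also have "\<dots> = integral {0..t} (\<lambda>s. l s * norm (y s - x s)) + \<bar>e\<bar> * integral {0..t} (\<lambda>s. norm (F (x s) \<theta> *v v s))"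
        using int1 int2 by (simp add: integral_add integrable_on_mult_right)
      also have "integral {0..t} (\<lambda>s. norm (F (x s) \<theta> *v v s)) \<le> c"
        unfolding c_def by (rule integral_subset_le[OF sub int2]) auto
      finally show "norm (y t - x t) \<le> \<bar>e\<bar> * c + integral {0..t} (\<lambda>s. l s * norm (y s - x s))"
        by (simp add: mult_left_mono)
    qed auto
    also have "\<dots> \<le> 2 * (\<bar>e\<bar> * c) * exp (2 * integral {0..1} l)"
    proof (rule mult_left_mono)
      have li: "l integrable_on {0..1}" using l by (simp add: absolutely_integrable_on_def)
      have "integral {0..t} l \<le> integral {0..1} l"
        using t l0 by (intro integral_subset_le integrable_on_subinterval[OF li]) auto
      then show "exp (2 * integral {0..t} l) \<le> exp (2 * integral {0..1} l)" by simp
      have "c \<ge> 0" unfolding c_def using Fv by (intro integral_nonneg) (auto simp: absolutely_integrable_on_def)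
      then show "0 \<le> 2 * (\<bar>e\<bar> * c)" by simp
    qed
    finally show ?thesis by (simp add: x_def y_def w_def[abs_def] mult_ac)
  qed
  then show ?thesis using that by blast
qed

end

section \<open>Costates and the variation of the terminal cost\<close>

lemma abs_cont_inner:
  fixes f g :: "real \<Rightarrow> 'a::real_inner"
  assumes f: "abs_cont_on_interval a b f" and g: "abs_cont_on_interval a b g"
  shows "abs_cont_on_interval a b (\<lambda>t. f t \<bullet> g t)"
proof -
  have "bounded (f ` {a..b})" "bounded (g ` {a..b})"
    by (intro compact_imp_bounded compact_continuous_image abs_cont_imp_continuous_on f g compact_Icc)+
  then obtain M1 M2 where M: "\<forall>y\<in>f ` {a..b}. norm y \<le> M1" "\<forall>y\<in>g ` {a..b}. norm y \<le> M2"
    unfolding bounded_iff by blast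
  define M where "M = max M1 M2"
  have fM: "norm (f t) \<le> M" and gM: "norm (g t) \<le> M" if "t \<in> {a..b}" for t
    using M that by (force simp: M_def)+
  show ?thesis
  proof (rule abs_cont_dominated2[OF f g, where C = M])
    fix s t assume st: "s \<in> {a..b}" "t \<in> {a..b}"
    have "f t \<bullet> g t - f s \<bullet> g s = (f t - f s) \<bullet> g t + f s \<bullet> (g t - g s)"
      by (simp add: inner_diff_left inner_diff_right)
    also have "norm \<dots> \<le> norm (f t - f s) * norm (g t) + norm (f s) * norm (g t - g s)"
      unfolding real_norm_def by (intro order_trans[OF abs_triangle_ineq] add_mono Cauchy_Schwarz_ineq2)
    also have "\<dots> \<le> norm (f t - f s) * M + M * norm (g t - g s)"
      using fM[OF st(1)] gM[OF st(2)] by (intro add_mono mult_left_mono mult_right_mono) auto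
    finally show "norm (f t \<bullet> g t - f s \<bullet> g s) \<le> M * (norm (f t - f s) + norm (g t - g s))"
      by (simp add: algebra_simps)
  qed
qed

context control_system
begin

text \<open>With the names of the proof, the adjoint equation turns the derivative of
  \<open>l t \<bullet> (y n t - x t)\<close> into
  \<open>l t \<bullet> (r n t - A t *v (y n t - x t))\<close>: the costate is paired only with what
  the linearisation along \<open>x\<close> leaves over.\<close>

lemma costate_variation:
  fixes u v :: "real \<Rightarrow> real^'k" and l :: "real \<Rightarrow> real^'n"
  assumes u: "u absolutely_integrable_on {0..1}" and v: "v absolutely_integrable_on {0..1}"
    and lac: "abs_cont_on_interval 0 1 l"
    and l': "AE t in lebesgue_on {0..1}. (l has_vector_derivative - (l t v* jac (traj u t) (u t))) (at t within {0..1})"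
  shows "(\<lambda>n. (l 1 \<bullet> (traj (\<lambda>s. u s + inverse (real (Suc n)) *\<^sub>R v s) 1 - traj u 1)) / inverse (real (Suc n)))
    \<longlonglongrightarrow> integral {0..1} (\<lambda>s. l s \<bullet> (F (traj u s) \<theta> *v v s))"
proof -
  define x where "x = traj u"
  define e where "e n = inverse (real (Suc n))" for n
  define w where "w n = (\<lambda>s. u s + e n *\<^sub>R v s)" for n
  define y where "y n = traj (w n)" for n
  define A where "A s = jac (x s) (u s)" for s
  define r where "r n s = rhs (w n) (y n) s - rhs u x s" for n s
  define p where "p n s = (l s \<bullet> (r n s - A s *v (y n s - x s))) / e n" for n s
  have e: "e n > 0" "\<bar>e n\<bar> \<le> 1" for n by (auto simp: e_def field_simps)
  have elim: "e \<longlonglongrightarrow> 0" unfolding e_def by (rule LIMSEQ_inverse_real_of_nat)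
  have w: "w n absolutely_integrable_on {0..1}" for n
    unfolding w_def by (rule control_perturbation_integrable[OF u v])
  have solx: "solves_control_system F0 F x0 u \<theta> x" unfolding x_def by (rule trajectory_solves[OF u])
  have soly: "solves_control_system F0 F x0 (w n) \<theta> (y n)" for n unfolding y_def by (rule trajectory_solves[OF w])
  have cx: "continuous_on {0..1} x" unfolding x_def by (rule continuous_trajectory[OF u])
  have cl: "continuous_on {0..1} l" by (rule abs_cont_imp_continuous_on[OF lac])
  have int: "(p n has_integral (l 1 \<bullet> (y n 1 - x 1)) / e n) {0..1}" for n
  proof -
    have acd: "abs_cont_on_interval 0 1 (\<lambda>t. y n t - x t)"
    proof (rule abs_cont_dominated2[where C = 1])
      show "abs_cont_on_interval 0 1 (y n)" "abs_cont_on_interval 0 1 x"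
        using solx soly by (auto simp: solves_control_system_def)
      show "norm (y n t - x t - (y n s - x s)) \<le> 1 * (norm (y n t - y n s) + norm (x t - x s))" for s t
        using norm_triangle_ineq4[of "y n t - y n s" "x t - x s"] by (simp add: algebra_simps)
    qed
    have "((\<lambda>s. l s \<bullet> (r n s - A s *v (y n s - x s))) has_integral
        l 1 \<bullet> (y n 1 - x 1) - l 0 \<bullet> (y n 0 - x 0)) {0..1}"
    proof (rule abs_cont_AE_has_integral[OF abs_cont_inner[OF lac acd]])
      have "AE t in lebesgue_on {0..1}. (x has_vector_derivative rhs u x t) (at t within {0..1})"
        "AE t in lebesgue_on {0..1}. (y n has_vector_derivative rhs (w n) (y n) t) (at t within {0..1})"
        using solx soly by (auto simp: solves_control_system_def)
      then show "AE t in lebesgue_on {0..1}. ((\<lambda>t. l t \<bullet> (y n t - x t)) has_vector_derivative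
          l t \<bullet> (r n t - A t *v (y n t - x t))) (at t within {0..1})"
        using l'
      proof eventually_elim
        case (elim t)
        then have "((\<lambda>t. l t \<bullet> (y n t - x t)) has_vector_derivative
            l t \<bullet> (rhs (w n) (y n) t - rhs u x t) + (- (l t v* A t)) \<bullet> (y n t - x t)) (at t within {0..1})"
          unfolding x_def[symmetric] A_def[symmetric]
          by (intro bounded_bilinear.has_vector_derivative[OF bounded_bilinear_inner] has_vector_derivative_diff)
        moreover have "l t \<bullet> (rhs (w n) (y n) t - rhs u x t) + (- (l t v* A t)) \<bullet> h = l t \<bullet> (r n t - A t *v h)" for h
          by (simp add: r_def dot_lmul_matrix inner_diff_right)
        ultimately show ?case by (simp only:)
      qed
    qed auto
    \<comment> \<open>The boundary term at time 0 vanishes because both trajectories start at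
      \<open>x0 \<theta>\<close>.\<close>
    moreover have "y n 0 = x 0" using solx soly by (auto simp: solves_control_system_def)
    ultimately have "((\<lambda>s. l s \<bullet> (r n s - A s *v (y n s - x s))) has_integral l 1 \<bullet> (y n 1 - x 1)) {0..1}" by simp
    then show ?thesis unfolding p_def by (rule has_integral_divide)
  qed
  obtain C where C: "\<forall>e t. \<bar>e\<bar> \<le> 1 \<longrightarrow> t \<in> {0..1} \<longrightarrow>
      norm (traj (\<lambda>s. u s + e *\<^sub>R v s) t - traj u t) \<le> C * \<bar>e\<bar>"
    using trajectory_perturbation[OF u v] by blast
  have d: "norm (y n t - x t) \<le> C * e n" if "t \<in> {0..1}" for n t
    using C[rule_format, OF e(2)[of n] that] e(1)[of n] by (simp add: y_def w_def x_def)
  have C0: "C \<ge> 0" using order_trans[OF norm_ge_zero d[of 0 0]] e(1)[of 0] by (simp add: zero_le_mult_iff)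
  obtain M where M: "\<And>(B :: real^'n^'n) h. norm (B *v h) \<le> M * norm B * norm h" "M > 0"
    using bilinear_bounded_pos[OF bilinear_matrix_vector_mult[where 'k = 'n and 'n = 'n]] by blast
  have "bounded (l ` {0..1})" by (intro compact_imp_bounded compact_continuous_image cl compact_Icc)
  then obtain B where "\<forall>y\<in>l ` {0..1}. norm y \<le> B" unfolding bounded_iff by blast
  then have B: "norm (l s) \<le> B" if "s \<in> {0..1}" for s using that by blast
  have B0: "B \<ge> 0" using order_trans[OF norm_ge_zero B[of 0]] by simp
  \<comment> \<open>After division by \<open>e n\<close>, the first two summands bound
    \<open>r n s\<close> through \<open>rhs_perturbation_bound\<close>, the last one bounds
    \<open>A s *v (y n s - x s)\<close>, and \<open>B\<close> bounds the costate. By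
    \<open>d\<close> nothing depends on \<open>n\<close>.\<close>
  define q where "q s = B * ((K * C * (1 + (norm (u s) + norm (v s))) + norm (F (x s) \<theta> *v v s)) + M * C * norm (A s))" for s
  have q: "q integrable_on {0..1}"
  proof -
    have "(\<lambda>s. norm (u s)) absolutely_integrable_on {0..1}" "(\<lambda>s. norm (v s)) absolutely_integrable_on {0..1}"
      using absolutely_integrable_norm[OF u, unfolded o_def] absolutely_integrable_norm[OF v, unfolded o_def] .
    moreover have "(\<lambda>s. norm (F (x s) \<theta> *v v s)) absolutely_integrable_on {0..1}"
      by (intro absolutely_integrable_norm[unfolded o_def]
          absolutely_integrable_continuous_bilinear[OF bilinear_matrix_vector_mult _ v]
          continuous_on_compose2[OF continuous_control cx]) auto
    moreover have "(\<lambda>s. norm (A s)) absolutely_integrable_on {0..1}"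
      unfolding A_def by (intro absolutely_integrable_norm[unfolded o_def] jac_integrable u cx)
    ultimately show ?thesis
      unfolding q_def absolutely_integrable_on_def
      by (intro integrable_on_mult_right integrable_add integrable_const_ivl) auto
  qed
  have "(\<lambda>n. integral {0..1} (p n)) \<longlonglongrightarrow> integral {0..1} (\<lambda>s. l s \<bullet> (F (x s) \<theta> *v v s))"
  proof (rule dominated_convergence(2)[OF _ q])
    show "p n integrable_on {0..1}" for n using int[of n] by (rule has_integral_integrable)
    show "norm (p n s) \<le> q s" if s: "s \<in> {0..1}" for n s
    proof -
      have "norm (r n s) \<le> K * (1 + (norm (u s) + norm (v s))) * norm (y n s - x s) + \<bar>e n\<bar> * norm (F (x s) \<theta> *v v s)"
        unfolding r_def w_def by (rule rhs_perturbation_bound[OF e(2)])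
      also have "\<dots> \<le> K * (1 + (norm (u s) + norm (v s))) * (C * e n) + e n * norm (F (x s) \<theta> *v v s)"
        using K e(1)[of n] d[OF s] by (intro add_mono mult_left_mono) auto
      finally have "norm (r n s) \<le> K * (1 + (norm (u s) + norm (v s))) * (C * e n) + e n * norm (F (x s) \<theta> *v v s)" .
      moreover have "norm (A s *v (y n s - x s)) \<le> M * norm (A s) * (C * e n)"
        using M(2) d[OF s, of n] by (intro order_trans[OF M(1)] mult_left_mono) auto
      ultimately have "norm (r n s - A s *v (y n s - x s)) \<le>
          (K * (1 + (norm (u s) + norm (v s))) * (C * e n) + e n * norm (F (x s) \<theta> *v v s)) + M * norm (A s) * (C * e n)"
        by (intro order_trans[OF norm_triangle_ineq4] add_mono)
      also have "\<dots> = ((K * C * (1 + (norm (u s) + norm (v s))) + norm (F (x s) \<theta> *v v s)) + M * C * norm (A s)) * e n"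
        by (simp add: algebra_simps)
      finally have bd: "norm (r n s - A s *v (y n s - x s)) \<le> \<dots>" .
      have "\<bar>l s \<bullet> (r n s - A s *v (y n s - x s))\<bar> \<le> norm (l s) * norm (r n s - A s *v (y n s - x s))"
        by (rule Cauchy_Schwarz_ineq2)
      also have "\<dots> \<le> B * (((K * C * (1 + (norm (u s) + norm (v s))) + norm (F (x s) \<theta> *v v s)) + M * C * norm (A s)) * e n)"
        using B[OF s] B0 by (intro mult_mono bd) auto
      also have "\<dots> = q s * e n" by (simp add: q_def)
      finally show ?thesis using e(1)[of n] by (simp add: p_def pos_divide_le_eq abs_div_pos[symmetric])
    qed
    show "(\<lambda>n. p n s) \<longlonglongrightarrow> l s \<bullet> (F (x s) \<theta> *v v s)" if s: "s \<in> {0..1}" for s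
    proof -
      \<comment> \<open>\<open>?R\<close> is the remainder of the first-order expansion in the state
        with the control frozen at \<open>u s\<close>; differentiability at \<open>x s\<close> and
        the bound \<open>d\<close> send it to zero.\<close>
      let ?R = "\<lambda>n. (rhs u (y n) s - rhs u x s - A s *v (y n s - x s)) /\<^sub>R e n"
      have 1: "?R \<longlonglongrightarrow> 0"
        using has_derivative_quotient_limit[where y = "\<lambda>n. y n s" and e = e, OF has_derivative_rhs e(1) elim d[OF s]]
        unfolding A_def .
      have 2: "(\<lambda>n. (F (y n s) \<theta> - F (x s) \<theta>) *v v s) \<longlonglongrightarrow> 0"
      proof (rule Lim_null_comparison)
        show "(\<lambda>n. K * (C * e n) * norm (v s)) \<longlonglongrightarrow> 0"
          using elim by (auto intro!: tendsto_mult_left_zero tendsto_mult_right_zero)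
        show "\<forall>\<^sub>F n in sequentially. norm ((F (y n s) \<theta> - F (x s) \<theta>) *v v s) \<le> K * (C * e n) * norm (v s)"
          using K d[OF s] by (intro always_eventually allI order_trans[OF lip_control] mult_right_mono mult_left_mono) auto
      qed
      have "p n s = l s \<bullet> (?R n + (F (y n s) \<theta> - F (x s) \<theta>) *v v s + F (x s) \<theta> *v v s)" for n
      proof -
        have "r n s - A s *v (y n s - x s) = e n *\<^sub>R (?R n + (F (y n s) \<theta> - F (x s) \<theta>) *v v s + F (x s) \<theta> *v v s)"
          using e(1)[of n] unfolding r_def w_def rhs_perturbation
          by (simp add: scaleR_add_right) 
        then show ?thesis using e(1)[of n] by (simp add: p_def)
      qed
      moreover have "(\<lambda>n. l s \<bullet> (?R n + (F (y n s) \<theta> - F (x s) \<theta>) *v v s + F (x s) \<theta> *v v s)) \<longlonglongrightarrow>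
          l s \<bullet> (0 + 0 + F (x s) \<theta> *v v s)"
        by (intro tendsto_intros 1 2)
      ultimately show ?thesis by simp
    qed
  qed
  moreover have "integral {0..1} (p n) = (l 1 \<bullet> (y n 1 - x 1)) / e n" for n
    using int[of n] by (rule integral_unique)
  ultimately show ?thesis unfolding x_def y_def w_def e_def by simp
qed

text \<open>The last conjunct holds for all directions \<open>v\<close> with one and the same
  \<open>l\<close>, so the costate can be fixed before choosing a direction that is built from
  it.\<close>

lemma costate_exists:
  fixes u :: "real \<Rightarrow> real^'k"
  assumes u: "u absolutely_integrable_on {0..1}" and c: "C1_regular c"
  shows "\<exists>l. abs_cont_on_interval 0 1 l \<and>
    (AE t in lebesgue_on {0..1}. (l has_vector_derivative - (l t v* jac (traj u t) (u t))) (at t within {0..1})) \<and>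
    (GDERIV c (traj u 1) :> l 1) \<and>
    (\<forall>v. v absolutely_integrable_on {0..1} \<longrightarrow>
      (\<lambda>n. (c (traj (\<lambda>s. u s + inverse (real (Suc n)) *\<^sub>R v s) 1) - c (traj u 1)) / inverse (real (Suc n)))
        \<longlonglongrightarrow> integral {0..1} (\<lambda>s. l s \<bullet> (F (traj u s) \<theta> *v v s)))"
proof -
  obtain c' where c': "(c has_derivative blinfun_apply c') (at (traj u 1))"
    using c unfolding C1_regular_def by blast
  \<comment> \<open>The adjoint applied to 1 represents the real-valued derivative as an inner
    product, so \<open>p\<close> is the gradient of \<open>c\<close> at the endpoint.\<close>
  define p where "p = adjoint (blinfun_apply c') 1"
  have p: "blinfun_apply c' h = h \<bullet> p" for h
    using adjoint_works[of "blinfun_apply c'" h 1]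
    by (simp add: p_def bounded_linear.linear[OF blinfun.bounded_linear_right])
  have cp: "(c has_derivative (\<lambda>h. h \<bullet> p)) (at (traj u 1))"
    using c' p by (simp add: p[abs_def] fun_eq_iff)
  have A: "(\<lambda>s. jac (traj u s) (u s)) absolutely_integrable_on {0..1}"
    by (rule jac_integrable[OF u continuous_trajectory(1)[OF u]])
  obtain l where l: "continuous_on {0..1} l" "l 1 = p"
    "\<forall>t\<in>{0..1}. l t = l 0 + integral {0..t} (\<lambda>s. - (l s v* jac (traj u s) (u s)))"
    using adjoint_equation_existence[OF zero_le_one A, of p] by blast
  have li: "(\<lambda>s. - (l s v* jac (traj u s) (u s))) absolutely_integrable_on {0..1}"
    using absolutely_integrable_linear[OF absolutely_integrable_continuous_bilinear[OF bilinear_vector_matrix_mult l(1) A]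
        bounded_linear_minus[OF bounded_linear_ident]] by (simp add: o_def)
  note ac = integral_equation_imp_abs_cont[OF li l(3)[rule_format]]
  have "(\<lambda>n. (c (traj (\<lambda>s. u s + inverse (real (Suc n)) *\<^sub>R v s) 1) - c (traj u 1)) / inverse (real (Suc n)))
        \<longlonglongrightarrow> integral {0..1} (\<lambda>s. l s \<bullet> (F (traj u s) \<theta> *v v s))"
    if v: "v absolutely_integrable_on {0..1}" for v
  proof -
    define e where "e n = inverse (real (Suc n))" for n
    define z where "z n = traj (\<lambda>s. u s + e n *\<^sub>R v s) 1" for n
    have e: "e n > 0" "\<bar>e n\<bar> \<le> 1" for n by (auto simp: e_def field_simps)
    have elim: "e \<longlonglongrightarrow> 0" unfolding e_def by (rule LIMSEQ_inverse_real_of_nat)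
    obtain C where C: "\<forall>e t. \<bar>e\<bar> \<le> 1 \<longrightarrow> t \<in> {0..1} \<longrightarrow>
        norm (traj (\<lambda>s. u s + e *\<^sub>R v s) t - traj u t) \<le> C * \<bar>e\<bar>"
      using trajectory_perturbation[OF u v] by blast
    have d: "norm (z n - traj u 1) \<le> C * e n" for n
      using C[rule_format, OF e(2)[of n], of 1] e(1)[of n] by (simp add: z_def)
    have 1: "(\<lambda>n. (c (z n) - c (traj u 1) - (z n - traj u 1) \<bullet> p) /\<^sub>R e n) \<longlonglongrightarrow> 0"
      by (rule has_derivative_quotient_limit[OF cp e(1) elim d])
    have 2: "(\<lambda>n. (l 1 \<bullet> (z n - traj u 1)) / e n) \<longlonglongrightarrow> integral {0..1} (\<lambda>s. l s \<bullet> (F (traj u s) \<theta> *v v s))"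
      unfolding z_def e_def by (rule costate_variation[OF u v ac])
    \<comment> \<open>The quotient splits into the first-order remainder of \<open>c\<close> and a
      linear part whose coefficient \<open>p\<close> is the terminal value of the costate.\<close>
    have "(c (z n) - c (traj u 1)) / e n =
        (c (z n) - c (traj u 1) - (z n - traj u 1) \<bullet> p) /\<^sub>R e n + (l 1 \<bullet> (z n - traj u 1)) / e n" for n
      by (simp add: l(2) inner_commute divide_inverse algebra_simps)
    then show ?thesis using tendsto_add[OF 1 2] by (simp add: z_def e_def)
  qed
  moreover have "GDERIV c (traj u 1) :> l 1" using cp l(2) by (simp add: gderiv_def)
  ultimately show ?thesis using ac by blast
qed

end

section \<open>Square-integrable controls\<close>

lemma L2_unitD:
  assumes "u \<in> L2_unit"
  shows "u \<in> borel_measurable (lebesgue_on {0..1})" "integrable (lebesgue_on {0..1}) (\<lambda>t. (norm (u t))\<^sup>2)"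
  using assms by (auto simp: L2_unit_def)

lemma L2_unit_inner_integrable:
  assumes u: "u \<in> L2_unit" and v: "v \<in> L2_unit"
  shows "integrable (lebesgue_on {0..1}) (\<lambda>t. u t \<bullet> v t)"
proof (rule Bochner_Integration.integrable_bound)
  show "integrable (lebesgue_on {0..1}) (\<lambda>t. (norm (u t))\<^sup>2 + (norm (v t))\<^sup>2)"
    by (intro Bochner_Integration.integrable_add L2_unitD u v)
  show "(\<lambda>t. u t \<bullet> v t) \<in> borel_measurable (lebesgue_on {0..1})"
    by (intro borel_measurable_inner L2_unitD u v)
  have "\<bar>x \<bullet> y\<bar> \<le> \<bar>(norm x)\<^sup>2 + (norm y)\<^sup>2\<bar>" for x y :: 'a
  proof -
    have "0 \<le> (norm x)\<^sup>2" "0 \<le> (norm y)\<^sup>2" "0 \<le> (norm x - norm y)\<^sup>2" by simp_all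
    then have "norm x * norm y \<le> \<bar>(norm x)\<^sup>2 + (norm y)\<^sup>2\<bar>" unfolding power2_diff by linarith
    then show ?thesis using Cauchy_Schwarz_ineq2[of x y] by linarith
  qed
  then show "AE t in lebesgue_on {0..1}. norm (u t \<bullet> v t) \<le> norm ((norm (u t))\<^sup>2 + (norm (v t))\<^sup>2)"
    by simp
qed

lemma norm_add_scaleR_power2:
  fixes x y :: "'a::real_inner"
  shows "(norm (x + e *\<^sub>R y))\<^sup>2 = (norm x)\<^sup>2 + (2 * e * (x \<bullet> y) + e\<^sup>2 * (norm y)\<^sup>2)"
  unfolding power2_norm_eq_inner
  by (simp add: inner_add_left inner_add_right inner_commute power2_eq_square algebra_simps)

lemma L2_unit_add_scaleR:
  assumes u: "u \<in> L2_unit" and v: "v \<in> L2_unit"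
  shows "(\<lambda>t. u t + e *\<^sub>R v t) \<in> L2_unit"
  unfolding L2_unit_def
proof (intro CollectI conjI)
  show "(\<lambda>t. u t + e *\<^sub>R v t) \<in> borel_measurable (lebesgue_on {0..1})"
    using L2_unitD(1)[OF u] L2_unitD(1)[OF v] by simp
  show "integrable (lebesgue_on {0..1}) (\<lambda>t. (norm (u t + e *\<^sub>R v t))\<^sup>2)"
    unfolding norm_add_scaleR_power2
    using L2_unitD(2)[OF u] L2_unitD(2)[OF v] L2_unit_inner_integrable[OF u v] by simp
qed

lemma L2_unit_norm_power2: "(L2_unit_norm u)\<^sup>2 = (LINT t|lebesgue_on {0..1}. (norm (u t))\<^sup>2)"
  unfolding L2_unit_norm_def by (simp add: real_sqrt_pow2 integral_nonneg)

lemma L2_unit_norm_add_scaleR: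
  assumes u: "u \<in> L2_unit" and v: "v \<in> L2_unit"
  shows "(L2_unit_norm (\<lambda>t. u t + e *\<^sub>R v t))\<^sup>2 =
    (L2_unit_norm u)\<^sup>2 + (2 * e * (LINT t|lebesgue_on {0..1}. u t \<bullet> v t) + e\<^sup>2 * (L2_unit_norm v)\<^sup>2)"
  unfolding L2_unit_norm_power2 norm_add_scaleR_power2
  using L2_unitD[OF u] L2_unitD[OF v] L2_unit_inner_integrable[OF u v] by simp

lemma L2_unit_norm_scaleR: "L2_unit_norm (\<lambda>t. e *\<^sub>R v t) = \<bar>e\<bar> * L2_unit_norm v"
  unfolding L2_unit_norm_def by (simp add: power_mult_distrib real_sqrt_mult)

text \<open>The interval has finite measure, so \<open>1 + r\<^sup>2\<close> with
  \<open>r = norm (u t)\<close> is integrable, and it dominates \<open>r\<close>.\<close>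

lemma L2_unit_absolutely_integrable:
  assumes u: "u \<in> L2_unit"
  shows "u absolutely_integrable_on {0..1}"
proof -
  interpret finite_measure "lebesgue_on {0..1 :: real}"
    by (rule finite_measure_lebesgue_on) simp
  have "integrable (lebesgue_on {0..1}) (norm \<circ> u)"
  proof (rule Bochner_Integration.integrable_bound)
    show "integrable (lebesgue_on {0..1}) (\<lambda>t. 1 + (norm (u t))\<^sup>2)"
      by (intro Bochner_Integration.integrable_add integrable_const L2_unitD u)
    show "norm \<circ> u \<in> borel_measurable (lebesgue_on {0..1})"
      using L2_unitD(1)[OF u] by (simp add: comp_def)
    have "r \<le> \<bar>1 + r\<^sup>2\<bar>" for r :: real
    proof -
      have "r \<le> 1 + r\<^sup>2"
        using zero_le_power2[of "r - 1"] zero_le_power2[of r] unfolding power2_diff power_one mult_1_right by linarith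
      then show ?thesis by simp
    qed
    then show "AE t in lebesgue_on {0..1}. norm ((norm \<circ> u) t) \<le> norm (1 + (norm (u t))\<^sup>2)" by simp
  qed
  with L2_unitD(1)[OF u] show ?thesis by (simp add: absolutely_integrable_measurable)
qed

lemma continuous_on_imp_L2_unit:
  assumes "continuous_on {0..1} u"
  shows "u \<in> L2_unit"
proof -
  have "(\<lambda>t. (norm (u t))\<^sup>2) absolutely_integrable_on {0..1}"
    by (intro absolutely_integrable_continuous_real continuous_intros assms)
  then have "integrable (lebesgue_on {0..1}) (\<lambda>t. (norm (u t))\<^sup>2)"
    by (rule absolutely_integrable_imp_integrable) simp
  then show ?thesis
    unfolding L2_unit_def using continuous_imp_measurable_on_sets_lebesgue[OF assms] by simp
qed

section \<open>Local minimality and the pointwise maximum\<close>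

lemma L2_local_minimizer_directional_limit:
  assumes min: "L2_local_minimizer J u" and v: "v \<in> L2_unit"
    and lim: "(\<lambda>n. (J (\<lambda>t. u t + inverse (real (Suc n)) *\<^sub>R v t) - J u) / inverse (real (Suc n))) \<longlonglongrightarrow> D"
  shows "D \<ge> 0"
proof -
  obtain r where u: "u \<in> L2_unit" and r: "r > 0" "\<forall>w\<in>L2_unit. L2_unit_norm (\<lambda>t. w t - u t) < r \<longrightarrow> J u \<le> J w"
    using min unfolding L2_local_minimizer_def by blast
  have "(\<lambda>n. inverse (real (Suc n)) * L2_unit_norm v) \<longlonglongrightarrow> 0"
    by (rule tendsto_mult_left_zero[OF LIMSEQ_inverse_real_of_nat])
  then have "\<forall>\<^sub>F n in sequentially. inverse (real (Suc n)) * L2_unit_norm v < r"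
    using r(1) by (rule order_tendstoD)
  then have "\<forall>\<^sub>F n in sequentially. 0 \<le> (J (\<lambda>t. u t + inverse (real (Suc n)) *\<^sub>R v t) - J u) / inverse (real (Suc n))"
  proof eventually_elim
    case (elim n)
    define e where "e = inverse (real (Suc n))"
    have "e > 0" by (simp add: e_def)
    then have "L2_unit_norm (\<lambda>t. (u t + e *\<^sub>R v t) - u t) < r"
      using elim L2_unit_norm_scaleR[of e v] by (simp add: e_def)
    then have "J u \<le> J (\<lambda>t. u t + e *\<^sub>R v t)"
      by (rule r(2)[rule_format, OF L2_unit_add_scaleR[OF u v]])
    then show ?case unfolding e_def[symmetric] using \<open>e > 0\<close> by simp
  qed
  with lim show ?thesis by (rule tendsto_lowerbound) simp
qed

text \<open>Completing the square: under the stationarity relation the objective is a constant minus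
  \<open>\<beta> / 2\<close> times the squared distance from \<open>w\<close>.\<close>

lemma is_arg_max_linear_minus_quadratic:
  fixes g w :: "'a::real_inner"
  assumes "\<beta> > 0" "g = - \<beta> *\<^sub>R w"
  shows "is_arg_max (\<lambda>v. - (g \<bullet> v) - \<beta> / 2 * (norm v)\<^sup>2) (\<lambda>v. v \<in> UNIV) w"
proof -
  have "- (g \<bullet> v) - \<beta> / 2 * (norm v)\<^sup>2 = \<beta> / 2 * (norm w)\<^sup>2 - \<beta> / 2 * (norm (v - w))\<^sup>2" for v
    by (simp add: assms(2) power2_norm_eq_inner inner_diff_left inner_diff_right inner_commute algebra_simps)
  moreover have "0 \<le> \<beta> / 2 * (norm (v - w))\<^sup>2" for v using assms(1) by simp
  ultimately show ?thesis by (simp add: is_arg_max_def not_less)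
qed

text \<open>Each coefficient \<open>w $ i\<close> of the expansion in columns is bounded by
  \<open>norm w\<close>, and summing over the columns gives the factor
  \<open>CARD('k)\<close>.\<close>

lemma matrix_vector_mult_lipschitz:
  fixes A B :: "real^'k^'n"
  assumes "\<And>i. norm (column i A - column i B) \<le> c"
  shows "norm ((A - B) *v w) \<le> real CARD('k) * c * norm w"
proof -
  have "(A - B) *v w = (\<Sum>i\<in>UNIV. (w $ i) *\<^sub>R (column i A - column i B))"
    unfolding matrix_mult_sum by (intro sum.cong) (auto simp: column_def vec_eq_iff)
  also have "norm \<dots> \<le> (\<Sum>i\<in>(UNIV :: 'k set). c * norm w)"
  proof (rule sum_norm_le)
    fix i
    have "\<bar>w $ i\<bar> * norm (column i A - column i B) \<le> norm w * c"
      using assms[of i] by (intro mult_mono component_le_norm_cart) auto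
    then show "norm ((w $ i) *\<^sub>R (column i A - column i B)) \<le> c * norm w" by (simp add: mult.commute)
  qed
  finally show ?thesis by simp
qed

theorem theorem4p2:
  fixes F0 :: "real^'n \<Rightarrow> 'p::euclidean_space \<Rightarrow> real^'n"
    and F :: "real^'n \<Rightarrow> 'p \<Rightarrow> real^'k^'n"
    and x0 :: "'p \<Rightarrow> real^'n"
    and a :: "real^'n \<Rightarrow> 'p \<Rightarrow> real"
    and \<Theta> :: "'p set"
    and L \<beta> :: real
    and N :: nat
    and \<theta> :: "nat \<Rightarrow> 'p"
    and \<alpha> :: "nat \<Rightarrow> real"
    and u :: "real \<Rightarrow> real^'k"
  assumes "compact \<Theta>"
    and "L > 0"
    and "\<And>x1 x2 \<theta>1 \<theta>2. \<theta>1 \<in> \<Theta> \<Longrightarrow> \<theta>2 \<in> \<Theta> \<Longrightarrow>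
           norm (F0 x1 \<theta>1 - F0 x2 \<theta>2) \<le> L * (norm (x1 - x2) + norm (\<theta>1 - \<theta>2))"
    and "\<And>i x1 x2 \<theta>1 \<theta>2. \<theta>1 \<in> \<Theta> \<Longrightarrow> \<theta>2 \<in> \<Theta> \<Longrightarrow>
           norm (column i (F x1 \<theta>1) - column i (F x2 \<theta>2)) \<le> L * (norm (x1 - x2) + norm (\<theta>1 - \<theta>2))"
    and "continuous_on \<Theta> x0"
    and "continuous_on (UNIV \<times> \<Theta>) (\<lambda>(x, \<eta>). a x \<eta>)"
    and "\<And>x \<eta>. \<eta> \<in> \<Theta> \<Longrightarrow> a x \<eta> \<ge> 0"
    and "\<beta> > 0"
    and "\<And>\<eta>. \<eta> \<in> \<Theta> \<Longrightarrow> C1_regular (\<lambda>x. F0 x \<eta>)"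
    and "\<And>\<eta>. \<eta> \<in> \<Theta> \<Longrightarrow> C1_regular (\<lambda>x. F x \<eta>)"
    and "\<And>\<eta>. \<eta> \<in> \<Theta> \<Longrightarrow> C1_regular (\<lambda>x. a x \<eta>)"
    and "N \<ge> 1"
    and "\<And>j. j \<in> {1..N} \<Longrightarrow> \<theta> j \<in> \<Theta>"
    and "\<And>j. j \<in> {1..N} \<Longrightarrow> \<alpha> j > 0"
    and "(\<Sum>j=1..N. \<alpha> j) = 1"
    and "L2_local_minimizer (ensemble_cost F0 F x0 a \<beta> N \<alpha> \<theta>) u"
  shows "\<exists>l :: nat \<Rightarrow> real \<Rightarrow> real^'n.
     (\<forall>j\<in>{1..N}.
        abs_cont_on_interval 0 1 (l j) \<and>
        (AE t in lebesgue_on {0..1}.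
           (l j has_vector_derivative
              - (l j t v*
                  (jacobian (\<lambda>x. F0 x (\<theta> j)) (at (trajectory F0 F x0 u (\<theta> j) t)) +
                   (\<Sum>i\<in>UNIV. (u t $ i) *\<^sub>R
                      jacobian (\<lambda>x. column i (F x (\<theta> j))) (at (trajectory F0 F x0 u (\<theta> j) t))))))
           (at t within {0..1})) \<and>
        GDERIV (\<lambda>x. a x (\<theta> j)) (trajectory F0 F x0 u (\<theta> j) 1) :> l j 1) \<and>
     (AE t in lebesgue_on {0..1}.
        is_arg_max
          (\<lambda>v. (\<Sum>j=1..N. \<alpha> j * (- ((l j t v* F (trajectory F0 F x0 u (\<theta> j) t) (\<theta> j)) \<bullet> v)))
                 - \<beta> / 2 * (norm v)\<^sup>2)
          (\<lambda>v. v \<in> UNIV) (u t))"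
proof -
  \<comment> \<open>One constant for both fields: the drift needs \<open>L\<close>, the columnwise
    bounds on the control field cost the factor \<open>CARD('k)\<close>, and this factor is at least
    1.\<close>
  define K where "K = real CARD('k) * L"
  have "L \<le> K" using \<open>L > 0\<close> by (simp add: K_def mult_le_cancel_right1)
  have sys: "control_system F0 F (\<theta> j) K" if "j \<in> {1..N}" for j
  proof
    note j = assms(13)[OF that]
    show "K > 0" using \<open>L > 0\<close> by (simp add: K_def)
    show "norm (F0 x (\<theta> j) - F0 y (\<theta> j)) \<le> K * norm (x - y)" for x y
      using assms(3)[OF j j, of x y] mult_right_mono[OF \<open>L \<le> K\<close>, of "norm (x - y)"] by simp
    show "norm ((F x (\<theta> j) - F y (\<theta> j)) *v w) \<le> K * norm (x - y) * norm w" for x y w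
      using matrix_vector_mult_lipschitz[of "F x (\<theta> j)" "F y (\<theta> j)" "L * norm (x - y)" w]
        assms(4)[OF j j, of _ x y] by (simp add: K_def mult.assoc)
    show "C1_regular (\<lambda>x. F0 x (\<theta> j))" "C1_regular (\<lambda>x. F x (\<theta> j))" using assms(9,10)[OF j] .
  qed
  have u: "u \<in> L2_unit" using assms(16) by (simp add: L2_local_minimizer_def)
  note ui = L2_unit_absolutely_integrable[OF u]
  let ?X = "\<lambda>w j. trajectory F0 F x0 w (\<theta> j)"
  let ?e = "\<lambda>n. inverse (real (Suc n))"
  \<comment> \<open>Besides the properties claimed for a costate, \<open>P\<close> records the limit
    of the cost quotients, so that the family picked by \<open>bchoice\<close> has both.\<close>
  define P where "P j l \<longleftrightarrow> abs_cont_on_interval 0 1 l \<and>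
    (AE t in lebesgue_on {0..1}. (l has_vector_derivative
       - (l t v* (jacobian (\<lambda>x. F0 x (\<theta> j)) (at (?X u j t)) +
           (\<Sum>i\<in>UNIV. (u t $ i) *\<^sub>R jacobian (\<lambda>x. column i (F x (\<theta> j))) (at (?X u j t)))))) (at t within {0..1})) \<and>
    (GDERIV (\<lambda>x. a x (\<theta> j)) (?X u j 1) :> l 1) \<and>
    (\<forall>v. v absolutely_integrable_on {0..1} \<longrightarrow>
      (\<lambda>n. (a (?X (\<lambda>s. u s + ?e n *\<^sub>R v s) j 1) (\<theta> j) - a (?X u j 1) (\<theta> j)) / ?e n)
        \<longlonglongrightarrow> integral {0..1} (\<lambda>s. l s \<bullet> (F (?X u j s) (\<theta> j) *v v s)))" for j l
  have "\<forall>j\<in>{1..N}. \<exists>l. P j l"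
    unfolding P_def by (intro ballI control_system.costate_exists[OF sys ui] assms(11,13))
  from bchoice[OF this] obtain l where "\<forall>j\<in>{1..N}. P j (l j)" by blast
  then have l: "P j (l j)" if "j \<in> {1..N}" for j using that by blast
  define p where "p j t = l j t v* F (?X u j t) (\<theta> j)" for j t
  define g where "g t = (\<Sum>j=1..N. \<alpha> j *\<^sub>R p j t)" for t
  \<comment> \<open>The negative L2 gradient of the cost: \<open>g\<close> collects the terminal
    costs and \<open>\<beta> *\<^sub>R u t\<close> comes from the penalty.\<close>
  define v where "v t = - g t + (- \<beta>) *\<^sub>R u t" for t
  have cp: "continuous_on {0..1} (p j)" if j: "j \<in> {1..N}" for j
  proof -
    interpret control_system F0 F x0 "\<theta> j" K by (rule sys[OF j])
    have cF: "continuous_on {0..1} (\<lambda>t. F (?X u j t) (\<theta> j))"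
      by (rule continuous_on_compose2[OF continuous_control continuous_trajectory(1)[OF ui]]) auto
    have cl: "continuous_on {0..1} (l j)" using l[OF j] unfolding P_def by (intro abs_cont_imp_continuous_on) simp
    show ?thesis
      unfolding p_def by (rule bilinear_continuous_on_compose[OF cl cF bilinear_vector_matrix_mult])
  qed
  have "continuous_on {0..1} (\<lambda>t. - g t)" unfolding g_def by (intro continuous_intros cp)
  from L2_unit_add_scaleR[OF continuous_on_imp_L2_unit[OF this] u]
  have v: "v \<in> L2_unit" unfolding v_def .
  note vi = L2_unit_absolutely_integrable[OF v]
  \<comment> \<open>The derivative of the cost at \<open>u\<close> in direction \<open>v\<close>.
    The part of the penalty that is quadratic in the increment disappears in the limit.\<close>
  define D where "D = (\<Sum>j=1..N. \<alpha> j * integral {0..1} (\<lambda>s. p j s \<bullet> v s)) +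
      \<beta> * (LINT s|lebesgue_on {0..1}. u s \<bullet> v s)"
  have "(\<lambda>n. (ensemble_cost F0 F x0 a \<beta> N \<alpha> \<theta> (\<lambda>t. u t + ?e n *\<^sub>R v t) - ensemble_cost F0 F x0 a \<beta> N \<alpha> \<theta> u) / ?e n)
      \<longlonglongrightarrow> D"
  proof -
    let ?U = "LINT s|lebesgue_on {0..1}. u s \<bullet> v s"
    let ?Q = "\<lambda>j n. (a (?X (\<lambda>s. u s + ?e n *\<^sub>R v s) j 1) (\<theta> j) - a (?X u j 1) (\<theta> j)) / ?e n"
    have Q: "?Q j \<longlonglongrightarrow> integral {0..1} (\<lambda>s. p j s \<bullet> v s)" if "j \<in> {1..N}" for j
      using l[OF that] vi unfolding P_def p_def dot_lmul_matrix by blast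
    have "(\<lambda>n. (\<Sum>j=1..N. \<alpha> j * ?Q j n) + (\<beta> * ?U + \<beta> / 2 * (?e n * (L2_unit_norm v)\<^sup>2)))
        \<longlonglongrightarrow> (\<Sum>j=1..N. \<alpha> j * integral {0..1} (\<lambda>s. p j s \<bullet> v s)) + (\<beta> * ?U + \<beta> / 2 * (0 * (L2_unit_norm v)\<^sup>2))"
      by (intro tendsto_intros Q LIMSEQ_inverse_real_of_nat)
    moreover have "(ensemble_cost F0 F x0 a \<beta> N \<alpha> \<theta> (\<lambda>t. u t + ?e n *\<^sub>R v t) - ensemble_cost F0 F x0 a \<beta> N \<alpha> \<theta> u) / ?e n =
        (\<Sum>j=1..N. \<alpha> j * ?Q j n) + (\<beta> * ?U + \<beta> / 2 * (?e n * (L2_unit_norm v)\<^sup>2))" for n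
    proof -
      define e where "e = ?e n"
      have "e \<noteq> 0" by (simp add: e_def)
      have quad: "(\<beta> / 2 * (2 * e * ?U + e\<^sup>2 * (L2_unit_norm v)\<^sup>2)) / e = \<beta> * ?U + \<beta> / 2 * (e * (L2_unit_norm v)\<^sup>2)"
        using \<open>e \<noteq> 0\<close> by (simp add: field_simps power2_eq_square)
      have "(\<Sum>j=1..N. \<alpha> j * ((a (?X (\<lambda>s. u s + e *\<^sub>R v s) j 1) (\<theta> j) - a (?X u j 1) (\<theta> j)) / e)) =
          ((\<Sum>j=1..N. \<alpha> j * a (?X (\<lambda>s. u s + e *\<^sub>R v s) j 1) (\<theta> j)) - (\<Sum>j=1..N. \<alpha> j * a (?X u j 1) (\<theta> j))) / e"
        by (simp add: sum_subtractf[symmetric] sum_divide_distrib right_diff_distrib)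
      then show ?thesis
        unfolding e_def[symmetric] ensemble_cost_def L2_unit_norm_add_scaleR[OF u v] quad[symmetric]
        by (simp add: add_divide_distrib[symmetric] algebra_simps)
    qed
    ultimately show ?thesis unfolding D_def by simp
  qed
  from L2_local_minimizer_directional_limit[OF assms(16) v this] have "D \<ge> 0" .
  have pv: "integrable (lebesgue_on {0..1}) (\<lambda>s. p j s \<bullet> v s)" if "j \<in> {1..N}" for j
    by (intro L2_unit_inner_integrable continuous_on_imp_L2_unit cp that v)
  \<comment> \<open>The Henstock-Kurzweil integrals of the variation formula become Lebesgue
    integrals, so that all terms can be merged into one integrand.\<close>
  have "D = (\<Sum>j=1..N. \<alpha> j * (LINT s|lebesgue_on {0..1}. p j s \<bullet> v s)) + \<beta> * (LINT s|lebesgue_on {0..1}. u s \<bullet> v s)"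
    unfolding D_def using pv by (simp add: lebesgue_integral_eq_integral)
  also have "\<dots> = (LINT s|lebesgue_on {0..1}. (\<Sum>j=1..N. \<alpha> j * (p j s \<bullet> v s)) + \<beta> * (u s \<bullet> v s))"
  proof -
    have pv': "integrable (lebesgue_on {0..1}) (\<lambda>s. \<alpha> j * (p j s \<bullet> v s))" if "j \<in> {1..N}" for j
      by (intro integrable_mult_right pv that)
    have "integrable (lebesgue_on {0..1}) (\<lambda>s. \<Sum>j=1..N. \<alpha> j * (p j s \<bullet> v s))"
      by (intro Bochner_Integration.integrable_sum pv')
    moreover have "integrable (lebesgue_on {0..1}) (\<lambda>s. \<beta> * (u s \<bullet> v s))"
      by (intro integrable_mult_right L2_unit_inner_integrable u v)
    moreover have "(LINT s|lebesgue_on {0..1}. (\<Sum>j=1..N. \<alpha> j * (p j s \<bullet> v s))) =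
        (\<Sum>j=1..N. \<alpha> j * (LINT s|lebesgue_on {0..1}. p j s \<bullet> v s))"
      by (subst Bochner_Integration.integral_sum[OF pv']) simp_all
    ultimately show ?thesis by (simp del: One_nat_def)
  qed
  \<comment> \<open>The gradient \<open>g s + \<beta> *\<^sub>R u s\<close> equals
    \<open>- v s\<close>, so pairing it with \<open>v s\<close> gives minus a square, while
    \<open>D\<close> is nonnegative.\<close>
  also have "\<dots> = (LINT s|lebesgue_on {0..1}. - (norm (v s))\<^sup>2)"
  proof -
    have "(\<Sum>j=1..N. \<alpha> j * (p j s \<bullet> v s)) + \<beta> * (u s \<bullet> v s) = - (norm (v s))\<^sup>2" for s
    proof -
      have "(\<Sum>j=1..N. \<alpha> j * (p j s \<bullet> v s)) + \<beta> * (u s \<bullet> v s) = (g s + \<beta> *\<^sub>R u s) \<bullet> v s"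
        by (simp add: g_def inner_sum_left inner_add_left)
      also have "g s + \<beta> *\<^sub>R u s = - v s" by (simp add: v_def)
      finally show ?thesis by (simp add: power2_norm_eq_inner)
    qed
    then show ?thesis by simp
  qed
  also have "\<dots> = - (LINT s|lebesgue_on {0..1}. (norm (v s))\<^sup>2)" by simp
  finally have "(LINT s|lebesgue_on {0..1}. (norm (v s))\<^sup>2) \<le> 0" using \<open>D \<ge> 0\<close> by simp
  then have "(LINT s|lebesgue_on {0..1}. (norm (v s))\<^sup>2) = 0"
    by (intro antisym integral_nonneg) auto
  then have "AE s in lebesgue_on {0..1}. (norm (v s))\<^sup>2 = 0"
    using L2_unitD(2)[OF v] by (simp add: integral_nonneg_eq_0_iff_AE)
  then have "AE t in lebesgue_on {0..1}.
        is_arg_max (\<lambda>v. (\<Sum>j=1..N. \<alpha> j * (- (p j t \<bullet> v))) - \<beta> / 2 * (norm v)\<^sup>2) (\<lambda>v. v \<in> UNIV) (u t)"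
  proof eventually_elim
    case (elim t)
    then have "- g t = \<beta> *\<^sub>R u t" by (simp add: v_def)
    then have gt: "g t = - \<beta> *\<^sub>R u t" by (metis minus_minus scaleR_minus_left)
    have eq: "(\<Sum>j=1..N. \<alpha> j * (- (p j t \<bullet> w))) = - (g t \<bullet> w)" for w
      by (simp add: g_def inner_sum_left sum_negf)
    show ?case unfolding eq by (rule is_arg_max_linear_minus_quadratic[OF \<open>\<beta> > 0\<close> gt])
  qed
  moreover have "\<forall>j\<in>{1..N}. abs_cont_on_interval 0 1 (l j) \<and>
        (AE t in lebesgue_on {0..1}.
           (l j has_vector_derivative
              - (l j t v*
                  (jacobian (\<lambda>x. F0 x (\<theta> j)) (at (?X u j t)) +
                   (\<Sum>i\<in>UNIV. (u t $ i) *\<^sub>R jacobian (\<lambda>x. column i (F x (\<theta> j))) (at (?X u j t))))))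
           (at t within {0..1})) \<and>
        GDERIV (\<lambda>x. a x (\<theta> j)) (?X u j 1) :> l j 1"
    using l unfolding P_def by blast
  ultimately show ?thesis unfolding p_def by (intro exI[of _ l] conjI)
qed

end
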